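(* For every non-square discriminant $\Delta\in\mathbb{Z}$, genus equivalence implies $\mathbb{Q}$-equivalence: any two primitive integral binary quadratic forms of discriminant $\Delta$ that belong to the same genus are $\mathbb{Q}$-equivalent. For every fundamental discriminant $\Delta$, genus equivalence is also implied by $\mathbb{Q}$-equivalence: any two primitive integral binary quadratic forms of discriminant $\Delta$ that are $\mathbb{Q}$-equivalent belong to the same genus.
   Context: An integral binary quadratic form is $Q=lx^2+mxy+ry^2$ with $l,m,r\in\mathbb{Z}$; it is primitive if $\gcd(l,m,r)=1$; its discriminant is $m^2-4lr$. Groups act on forms by linear change of variables. $\mathrm{Cl}(\Delta)$ denotes the set of $\mathrm{PSL}_2(\mathbb{Z})$-classes of primitive integral binary quadratic forms of non-square discriminant $\Delta$; both relations below are invariant under $\mathrm{PSL}_2(\mathbb{Z})$-equivalence, hence are relations on $\mathrm{Cl}(\Delta)$. Two forms are $\mathbb{Q}$-equivalent if they lie in the same orbit under $\mathrm{PSL}_2(\mathbb{Q})$. Two forms (or classes) in $\mathrm{Cl}(\Delta)$ belong to the same genus (are genus equivalent) if they are conjugate under $\mathrm{SL}_2(\mathbb{Z}_p)$ for every prime number $p$ and also under $\mathrm{SL}_2(\mathbb{R})$. A fundamental discriminant is the discriminant of (the ring of integers of) a quadratic extension of $\mathbb{Q}$: either $\Delta\equiv1\pmod 4$ is square-free (and $\Delta\neq1$), or $\Delta=4m$ with $m$ square-free and $m\not\equiv1\pmod4$. *)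

theory Defs
  imports
    "HOL-Algebra.Algebraic_Closure_Type"
    "HOL-Number_Theory.Cong"
    "HOL-Computational_Algebra.Nth_Powers"
    "HOL-Computational_Algebra.Squarefree"
begin

section \<open>Binary quadratic forms\<close>

text \<open>\<open>BQF l m r\<close> is the form \<open>l x\<^sup>2 + m x y + r y\<^sup>2\<close>.\<close>

datatype 'a bqf = BQF (xx_coeff: 'a) (xy_coeff: 'a) (yy_coeff: 'a)

fun bqf_discriminant :: "int bqf \<Rightarrow> int" where
  "bqf_discriminant (BQF l m r) = m\<^sup>2 - 4 * l * r"

fun bqf_primitive :: "int bqf \<Rightarrow> bool" where
  "bqf_primitive (BQF l m r) \<longleftrightarrow> Gcd {l, m, r} = 1"

definition primitive_forms :: "int \<Rightarrow> int bqf set" where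
  "primitive_forms \<Delta> = {Q. bqf_primitive Q \<and> bqf_discriminant Q = \<Delta>}"

fun bqf_eval :: "('a, 'm) ring_scheme \<Rightarrow> 'a bqf \<Rightarrow> 'a \<Rightarrow> 'a \<Rightarrow> 'a" where
  "bqf_eval R (BQF l m r) x y =
     l \<otimes>\<^bsub>R\<^esub> (x \<otimes>\<^bsub>R\<^esub> x) \<oplus>\<^bsub>R\<^esub> m \<otimes>\<^bsub>R\<^esub> (x \<otimes>\<^bsub>R\<^esub> y) \<oplus>\<^bsub>R\<^esub> r \<otimes>\<^bsub>R\<^esub> (y \<otimes>\<^bsub>R\<^esub> y)"

text \<open>
  The tuple \<open>(a, b, c, d)\<close> is the matrix with rows \<open>(a, b)\<close> and \<open>(c, d)\<close>.
\<close>

definition SL2 :: "('a, 'm) ring_scheme \<Rightarrow> ('a \<times> 'a \<times> 'a \<times> 'a) set" where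
  "SL2 R = {(a, b, c, d). a \<in> carrier R \<and> b \<in> carrier R \<and> c \<in> carrier R \<and> d \<in> carrier R \<and>
              a \<otimes>\<^bsub>R\<^esub> d \<ominus>\<^bsub>R\<^esub> b \<otimes>\<^bsub>R\<^esub> c = \<one>\<^bsub>R\<^esub>}"

text \<open>
  The coefficients of \<open>Q (a x + b y, c x + d y)\<close>, expanded as a polynomial in \<open>x\<close> and \<open>y\<close>.
\<close>

fun bqf_subst :: "('a, 'm) ring_scheme \<Rightarrow> 'a bqf \<Rightarrow> 'a \<times> 'a \<times> 'a \<times> 'a \<Rightarrow> 'a bqf" where
  "bqf_subst R (BQF l m r) (a, b, c, d) = BQF
     (bqf_eval R (BQF l m r) a c)
     (l \<otimes>\<^bsub>R\<^esub> (a \<otimes>\<^bsub>R\<^esub> b) \<oplus>\<^bsub>R\<^esub> l \<otimes>\<^bsub>R\<^esub> (a \<otimes>\<^bsub>R\<^esub> b) \<oplus>\<^bsub>R\<^esub>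
        m \<otimes>\<^bsub>R\<^esub> (a \<otimes>\<^bsub>R\<^esub> d \<oplus>\<^bsub>R\<^esub> b \<otimes>\<^bsub>R\<^esub> c) \<oplus>\<^bsub>R\<^esub>
        (r \<otimes>\<^bsub>R\<^esub> (c \<otimes>\<^bsub>R\<^esub> d) \<oplus>\<^bsub>R\<^esub> r \<otimes>\<^bsub>R\<^esub> (c \<otimes>\<^bsub>R\<^esub> d)))
     (bqf_eval R (BQF l m r) b d)"

lemma (in cring) bqf_eval_subst:
  assumes "set_bqf Q \<subseteq> carrier R" "{a, b, c, d, x, y} \<subseteq> carrier R"
  shows "bqf_eval R (bqf_subst R Q (a, b, c, d)) x y =
           bqf_eval R Q (a \<otimes> x \<oplus> b \<otimes> y) (c \<otimes> x \<oplus> d \<otimes> y)"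
  using assms by (cases Q) (simp add: l_distr r_distr m_ac a_ac)

lemma (in cring) bqf_subst_uminus:
  assumes "set_bqf Q \<subseteq> carrier R" "{a, b, c, d} \<subseteq> carrier R"
  shows "bqf_subst R Q (\<ominus> a, \<ominus> b, \<ominus> c, \<ominus> d) = bqf_subst R Q (a, b, c, d)"
  using assms by (cases Q) (simp add: l_minus r_minus)

text \<open>Integers are mapped to \<open>R\<close> along the unique ring homomorphism.\<close>

definition bqf_base_change :: "('a, 'm) ring_scheme \<Rightarrow> int bqf \<Rightarrow> 'a bqf" where
  "bqf_base_change R = map_bqf (\<lambda>k. [k] \<cdot>\<^bsub>R\<^esub> \<one>\<^bsub>R\<^esub>)"

definition SL2_equivalent :: "('a, 'm) ring_scheme \<Rightarrow> int bqf \<Rightarrow> int bqf \<Rightarrow> bool" where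
  "SL2_equivalent R Q Q' \<longleftrightarrow>
     (\<exists>g \<in> SL2 R. bqf_subst R (bqf_base_change R Q) g = bqf_base_change R Q')"

section \<open>The ring of \<open>p\<close>-adic integers\<close>

text \<open>
  The inverse limit of the rings \<open>\<int>/p\<^sup>n\<close>; residues are represented by \<open>0, \<dots>, p\<^sup>n - 1\<close>.
\<close>

definition padic_ints :: "nat \<Rightarrow> (nat \<Rightarrow> int) ring" where
  "padic_ints p = \<lparr>
     carrier = {u. \<forall>n. 0 \<le> u n \<and> u n < int p ^ n \<and> u (Suc n) mod int p ^ n = u n},
     monoid.mult = (\<lambda>u v n. (u n * v n) mod int p ^ n),
     one = (\<lambda>n. 1 mod int p ^ n),
     ring.zero = (\<lambda>n. 0),
     add = (\<lambda>u v n. (u n + v n) mod int p ^ n)\<rparr>"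

lemma padic_ints_carrier_iff:
  "u \<in> carrier (padic_ints p) \<longleftrightarrow>
     (\<forall>n. 0 \<le> u n \<and> u n < int p ^ n \<and> u (Suc n) mod int p ^ n = u n)"
  by (simp add: padic_ints_def)

lemma padic_ints_of_seq:
  assumes "p > 0" "\<And>n. [f (Suc n) = f n] (mod int p ^ n)"
  shows "(\<lambda>n. f n mod int p ^ n) \<in> carrier (padic_ints p)"
  using assms by (auto simp: padic_ints_carrier_iff cong_def mod_mod_cancel)

lemma padic_ints_cong:
  assumes "u \<in> carrier (padic_ints p)"
  shows "[u (Suc n) = u n] (mod int p ^ n)"
  using assms by (metis padic_ints_carrier_iff cong_def mod_mod_trivial)

lemma cring_padic_ints:
  assumes "p > 0"
  shows "cring (padic_ints p)"
proof -
  let ?Z = "padic_ints p"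
  have ops: "u \<otimes>\<^bsub>?Z\<^esub> v = (\<lambda>n. (u n * v n) mod int p ^ n)"
      "u \<oplus>\<^bsub>?Z\<^esub> v = (\<lambda>n. (u n + v n) mod int p ^ n)"
      "\<one>\<^bsub>?Z\<^esub> = (\<lambda>n. 1 mod int p ^ n)" "\<zero>\<^bsub>?Z\<^esub> = (\<lambda>n. 0)" for u v
    by (simp_all add: padic_ints_def)
  have red: "u n mod int p ^ n = u n" if "u \<in> carrier ?Z" for u n
    using that by (simp add: padic_ints_carrier_iff)
  have neg: "\<exists>v \<in> carrier ?Z. v \<oplus>\<^bsub>?Z\<^esub> u = \<zero>\<^bsub>?Z\<^esub>" if "u \<in> carrier ?Z" for u
  proof
    show "(\<lambda>n. (- u n) mod int p ^ n) \<in> carrier ?Z"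
      using padic_ints_cong[OF that]
      by (intro padic_ints_of_seq[OF assms]) (simp add: cong_minus_minus_iff)
    show "(\<lambda>n. (- u n) mod int p ^ n) \<oplus>\<^bsub>?Z\<^esub> u = \<zero>\<^bsub>?Z\<^esub>"
      by (simp add: ops mod_simps)
  qed
  show ?thesis
  proof (rule cringI)
    show "abelian_group ?Z"
    proof (rule abelian_groupI)
      fix u v assume uv: "u \<in> carrier ?Z" "v \<in> carrier ?Z"
      show "u \<oplus>\<^bsub>?Z\<^esub> v \<in> carrier ?Z"
        unfolding ops
        by (intro padic_ints_of_seq[OF assms] cong_add padic_ints_cong uv)
      show "u \<oplus>\<^bsub>?Z\<^esub> v = v \<oplus>\<^bsub>?Z\<^esub> u"
        by (simp add: ops add.commute)
    next
      show "\<zero>\<^bsub>?Z\<^esub> \<in> carrier ?Z"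
        using assms by (simp add: ops padic_ints_carrier_iff)
    next
      fix u assume "u \<in> carrier ?Z"
      thus "\<exists>v \<in> carrier ?Z. v \<oplus>\<^bsub>?Z\<^esub> u = \<zero>\<^bsub>?Z\<^esub>"
        by (rule neg)
    qed (auto simp: ops mod_simps red ac_simps)
  next
    show "Group.comm_monoid ?Z"
    proof (rule comm_monoidI)
      fix u v assume uv: "u \<in> carrier ?Z" "v \<in> carrier ?Z"
      show "u \<otimes>\<^bsub>?Z\<^esub> v \<in> carrier ?Z"
        unfolding ops
        by (intro padic_ints_of_seq[OF assms] cong_mult padic_ints_cong uv)
    next
      show "\<one>\<^bsub>?Z\<^esub> \<in> carrier ?Z"
        unfolding ops by (intro padic_ints_of_seq[OF assms]) simp
    qed (auto simp: ops mod_simps red ac_simps)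
  qed (auto simp: ops mod_simps algebra_simps)
qed

section \<open>Equivalence relations on forms\<close>

text \<open>
  By \<open>bqf_subst_uminus\<close>, \<open>-1\<close> acts trivially, so the orbits of \<open>PSL\<^sub>2\<close> are the orbits of \<open>SL\<^sub>2\<close>.
\<close>

definition Q_equivalent :: "int bqf \<Rightarrow> int bqf \<Rightarrow> bool" where
  "Q_equivalent = SL2_equivalent (ring_of_type_algebra :: rat ring)"

definition genus_equivalent :: "int bqf \<Rightarrow> int bqf \<Rightarrow> bool" where
  "genus_equivalent Q Q' \<longleftrightarrow>
     (\<forall>p. prime p \<longrightarrow> SL2_equivalent (padic_ints p) Q Q') \<and>
     SL2_equivalent (ring_of_type_algebra :: real ring) Q Q'"

definition fundamental_discriminant :: "int \<Rightarrow> bool" where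
  "fundamental_discriminant \<Delta> \<longleftrightarrow>
     ([\<Delta> = 1] (mod 4) \<and> squarefree \<Delta> \<and> \<Delta> \<noteq> 1) \<or>
     (\<exists>m. \<Delta> = 4 * m \<and> squarefree m \<and> \<not> [m = 1] (mod 4))"

end

theory Submission
  imports Defs
begin

text \<open>
  Both directions rest on one observation. Let \<open>Q\<close> and \<open>Q' = l' x\<^sup>2 + m' x y + r' y\<^sup>2\<close> have the
  same discriminant. If \<open>Q\<close> takes the value \<open>l'\<close> at a vector over a ring in which \<open>l'\<close> is
  invertible, then this vector is the first column of a matrix of determinant \<open>1\<close> that carries
  \<open>Q\<close> to \<open>Q'\<close>, with an explicit second column free of the denominator \<open>2\<close> (\<open>second_column\<close>).
  Equivalence of forms is thereby reduced to the representation of one number.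

  From genus to \<open>\<rat>\<close>. Completing the square turns \<open>Q(x, y) = l' z\<^sup>2\<close> into the conic
  \<open>X\<^sup>2 - \<Delta> Y\<^sup>2 = 4 l l' Z\<^sup>2\<close>. If the forms are in the same genus, then it has points over \<open>\<real>\<close> and over
  every \<open>\<rat>\<^sub>p\<close>, so by the theorem of Legendre and Hasse (\<open>conic_local_global\<close>) it has a rational
  point, where \<open>Z \<noteq> 0\<close> because \<open>\<Delta>\<close> is not a square. That theorem is proved by descent: when \<open>b\<close> is
  squarefree, local solubility of \<open>x\<^sup>2 - a y\<^sup>2 = b z\<^sup>2\<close> makes \<open>a\<close> a square modulo \<open>b\<close>, and an equation
  \<open>t\<^sup>2 - a = b b'\<close> with small \<open>t\<close> says that \<open>b b'\<close> is a norm from \<open>\<rat>(\<surd>a)\<close>; hence \<open>b\<close> may be replaced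
  by the smaller number \<open>b'\<close>, both locally and globally.

  From \<open>\<rat>\<close> to the genus. Over \<open>\<real>\<close> there is nothing to do. At a prime \<open>p\<close>, the primitive form \<open>Q'\<close>
  may be assumed to have a leading coefficient \<open>u\<close> prime to \<open>p\<close>, and \<open>Q\<close> represents \<open>u\<close> rationally. If
  this representation has a denominator divisible by \<open>p\<close>, then clearing it yields a primitive vector
  at which \<open>Q\<close> is divisible by \<open>p\<^sup>2\<close>. For fundamental \<open>\<Delta>\<close> the middle coefficient, in a basis that
  starts with this vector, is then prime to \<open>p\<close>, so \<open>Q\<close> is a hyperbolic plane at \<open>p\<close> and represents
  everything by Hensel's lemma. In all cases \<open>Q\<close> represents \<open>u\<close> modulo every power of \<open>p\<close>; the forms
  are therefore equivalent modulo every power of \<open>p\<close>, and by compactness over \<open>\<int>\<^sub>p\<close>.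
\<close>

section \<open>Conics and local solubility\<close>

definition conic_soluble :: "int \<Rightarrow> int \<Rightarrow> bool" where
  "conic_soluble a b \<longleftrightarrow>
     (\<exists>x y z. (x, y, z) \<noteq> (0, 0, 0) \<and> x\<^sup>2 - a * y\<^sup>2 - b * z\<^sup>2 = 0)"

text \<open>
  By compactness of \<open>\<int>\<^sub>p\<close> this is the existence of a nonzero \<open>p\<close>-adic point. Allowing a bounded
  common factor \<open>p\<^sup>C\<close>, instead of asking for primitive solutions, makes the notion visibly stable
  under integral changes of variables with nonzero determinant.
\<close>

definition conic_soluble_at :: "nat \<Rightarrow> int \<Rightarrow> int \<Rightarrow> bool" where
  "conic_soluble_at p a b \<longleftrightarrow>
     (\<exists>C. \<forall>n. \<exists>x y z. \<not> (int p ^ C dvd x \<and> int p ^ C dvd y \<and> int p ^ C dvd z) \<and>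
        int p ^ n dvd x\<^sup>2 - a * y\<^sup>2 - b * z\<^sup>2)"

lemma conic_soluble_commute: "conic_soluble a b \<longleftrightarrow> conic_soluble b a"
proof -
  have "conic_soluble b a" if sol: "conic_soluble a b" for a b
  proof -
    from sol obtain x y z where "(x, y, z) \<noteq> (0, 0, 0)" "x\<^sup>2 - a * y\<^sup>2 - b * z\<^sup>2 = 0"
      by (auto simp: conic_soluble_def)
    hence "(x, z, y) \<noteq> (0, 0, 0) \<and> x\<^sup>2 - b * z\<^sup>2 - a * y\<^sup>2 = 0" by auto
    thus ?thesis unfolding conic_soluble_def by blast
  qed
  thus ?thesis by blast
qed

lemma conic_soluble_at_commute: "conic_soluble_at p a b \<longleftrightarrow> conic_soluble_at p b a"
proof -
  have "conic_soluble_at p b a" if sol: "conic_soluble_at p a b" for a b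
  proof -
    have *: "x\<^sup>2 - a * y\<^sup>2 - b * z\<^sup>2 = x\<^sup>2 - b * z\<^sup>2 - a * y\<^sup>2" for x y z :: int
      by simp
    from sol show ?thesis unfolding conic_soluble_at_def * by blast
  qed
  thus ?thesis by blast
qed

lemma prime_power_dvd_cancel:
  fixes D :: int
  assumes "prime p" "D \<noteq> 0"
  obtains e where "\<And>C v. p ^ (C + e) dvd D * v \<Longrightarrow> p ^ C dvd v"
proof
  fix C v
  assume dvd: "p ^ (C + multiplicity p D) dvd D * v"
  obtain D' where D': "D = p ^ multiplicity p D * D'" "\<not> p dvd D'"
    using assms by (metis multiplicity_decompose' not_prime_unit)
  have "p ^ multiplicity p D * p ^ C dvd p ^ multiplicity p D * (D' * v)"
    using dvd D'(1) by (metis mult.assoc mult.commute power_add)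
  hence "p ^ C dvd D' * v"
    using assms(1) by (subst (asm) dvd_mult_cancel_left) auto
  moreover have "coprime (p ^ C) D'"
    using assms(1) D'(2) by (simp add: prime_imp_coprime)
  ultimately show "p ^ C dvd v"
    by (simp add: coprime_dvd_mult_right_iff)
qed

text \<open>
  The hypothesis on \<open>D\<close> holds for linear \<open>f\<close> with determinant \<open>D\<close>, by multiplication with
  the adjugate matrix: \<open>f\<close> can increase the power of \<open>p\<close> that divides a vector by no more than the
  multiplicity of \<open>p\<close> in \<open>D\<close>.
\<close>

lemma conic_soluble_at_transform:
  fixes f :: "int \<times> int \<times> int \<Rightarrow> int \<times> int \<times> int"
  assumes p: "prime p" and D: "D \<noteq> 0" and sol: "conic_soluble_at p a b"
    and adj: "\<And>N x y z x' y' z'. f (x, y, z) = (x', y', z') \<Longrightarrow>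
                N dvd x' \<Longrightarrow> N dvd y' \<Longrightarrow> N dvd z' \<Longrightarrow> N dvd D * x \<and> N dvd D * y \<and> N dvd D * z"
    and form: "\<And>x y z x' y' z'. f (x, y, z) = (x', y', z') \<Longrightarrow>
                x\<^sup>2 - a * y\<^sup>2 - b * z\<^sup>2 dvd x'\<^sup>2 - a' * y'\<^sup>2 - b' * z'\<^sup>2"
  shows "conic_soluble_at p a' b'"
proof -
  obtain e where e: "\<And>C v. int p ^ (C + e) dvd D * v \<Longrightarrow> int p ^ C dvd v"
    using prime_power_dvd_cancel[of "int p" D] p D by auto
  from sol obtain C where C: "\<And>n. \<exists>x y z. \<not> (int p ^ C dvd x \<and> int p ^ C dvd y \<and> int p ^ C dvd z) \<and>
        int p ^ n dvd x\<^sup>2 - a * y\<^sup>2 - b * z\<^sup>2"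
    by (auto simp: conic_soluble_at_def)
  show ?thesis unfolding conic_soluble_at_def
  proof (rule exI[of _ "C + e"], rule allI)
    fix n
    from C[of n] obtain x y z where
      xyz: "\<not> (int p ^ C dvd x \<and> int p ^ C dvd y \<and> int p ^ C dvd z)"
        "int p ^ n dvd x\<^sup>2 - a * y\<^sup>2 - b * z\<^sup>2" by blast
    obtain x' y' z' where f: "f (x, y, z) = (x', y', z')" by (metis prod_cases3)
    have "\<not> (int p ^ (C + e) dvd x' \<and> int p ^ (C + e) dvd y' \<and> int p ^ (C + e) dvd z')"
      using adj[OF f] e xyz(1) by blast
    moreover have "int p ^ n dvd x'\<^sup>2 - a' * y'\<^sup>2 - b' * z'\<^sup>2"
      using form[OF f] xyz(2) dvd_trans by blast
    ultimately show "\<exists>x y z. \<not> (int p ^ (C + e) dvd x \<and> int p ^ (C + e) dvd y \<and> int p ^ (C + e) dvd z) \<and>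
        int p ^ n dvd x\<^sup>2 - a' * y\<^sup>2 - b' * z\<^sup>2" by blast
  qed
qed

lemma conic_soluble_at_square_factor:
  assumes "prime p" "k \<noteq> 0" "conic_soluble_at p a (k\<^sup>2 * b)"
  shows "conic_soluble_at p a b"
  using assms
  by (rule conic_soluble_at_transform[where f = "\<lambda>(x, y, z). (x, y, k * z)"])
     (auto simp: power_mult_distrib algebra_simps)

lemma conic_soluble_square_factor:
  assumes "k \<noteq> 0" "conic_soluble a b"
  shows "conic_soluble a (k\<^sup>2 * b)"
proof -
  from assms(2) obtain x y z where sol: "(x, y, z) \<noteq> (0, 0, 0)" "x\<^sup>2 - a * y\<^sup>2 - b * z\<^sup>2 = 0"
    by (auto simp: conic_soluble_def)
  have "(k * x)\<^sup>2 - a * (k * y)\<^sup>2 - k\<^sup>2 * b * z\<^sup>2 = k\<^sup>2 * (x\<^sup>2 - a * y\<^sup>2 - b * z\<^sup>2)"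
    by (simp add: power_mult_distrib algebra_simps)
  with sol assms(1) show ?thesis
    unfolding conic_soluble_def
    by (intro exI[of _ "k * x"] exI[of _ "k * y"] exI[of _ z]) auto
qed

text \<open>
  With \<open>N\<close> the norm from \<open>\<rat>(\<surd>a)\<close>, a solution reads \<open>N(x + y \<surd>a) = b z\<^sup>2\<close>. Multiplying by
  \<open>N(t + \<surd>a) = b b'\<close> gives \<open>N((x + y \<surd>a) (t + \<surd>a)) = b' (b z)\<^sup>2\<close>.
\<close>

lemma conic_soluble_at_norm:
  assumes "prime p" and bb: "b * b' = t\<^sup>2 - a" "b * b' \<noteq> 0" and "conic_soluble_at p a b"
  shows "conic_soluble_at p a b'"
  using assms(1) bb(2) assms(4)
proof (rule conic_soluble_at_transform[where f = "\<lambda>(x, y, z). (t * x + a * y, x + t * y, b * z)"])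
  fix N x y z x' y' z' :: int
  assume f: "(case (x, y, z) of (x, y, z) \<Rightarrow> (t * x + a * y, x + t * y, b * z)) = (x', y', z')"
  have a: "a = t\<^sup>2 - b * b'" using bb by simp
  have f': "x' = t * x + a * y" "y' = x + t * y" "z' = b * z" using f by auto
  have eqs: "b * b' * x = t * x' - a * y'" "b * b' * y = t * y' - x'" "b * b' * z = b' * z'"
    unfolding f' a by (simp_all add: algebra_simps power2_eq_square)
  assume "N dvd x'" "N dvd y'" "N dvd z'"
  thus "N dvd b * b' * x \<and> N dvd b * b' * y \<and> N dvd b * b' * z"
    unfolding eqs by auto
next
  fix x y z x' y' z' :: int
  assume f: "(case (x, y, z) of (x, y, z) \<Rightarrow> (t * x + a * y, x + t * y, b * z)) = (x', y', z')"
  have a: "a = t\<^sup>2 - b * b'" using bb by simp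
  have f': "x' = t * x + a * y" "y' = x + t * y" "z' = b * z" using f by auto
  have "x'\<^sup>2 - a * y'\<^sup>2 - b' * z'\<^sup>2 = b * b' * (x\<^sup>2 - a * y\<^sup>2 - b * z\<^sup>2)"
    unfolding f' a by (simp add: algebra_simps power2_eq_square)
  thus "x\<^sup>2 - a * y\<^sup>2 - b * z\<^sup>2 dvd x'\<^sup>2 - a * y'\<^sup>2 - b' * z'\<^sup>2" by simp
qed

lemma conic_soluble_norm:
  assumes bb: "b * b' = t\<^sup>2 - a" "b * b' \<noteq> 0" and "conic_soluble a b'"
  shows "conic_soluble a b"
proof -
  from assms(3) obtain x y z where sol: "(x, y, z) \<noteq> (0, 0, 0)" "x\<^sup>2 - a * y\<^sup>2 - b' * z\<^sup>2 = 0"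
    by (auto simp: conic_soluble_def)
  have a: "a = t\<^sup>2 - b * b'" using bb by simp
  have "(t * x + a * y)\<^sup>2 - a * (x + t * y)\<^sup>2 - b * (b' * z)\<^sup>2
      = b * b' * (x\<^sup>2 - a * y\<^sup>2 - b' * z\<^sup>2)"
    unfolding a by (auto simp: algebra_simps power2_eq_square)
  moreover have "(t * x + a * y, x + t * y, b' * z) \<noteq> (0, 0, 0)"
  proof
    assume 0: "(t * x + a * y, x + t * y, b' * z) = (0, 0, 0)"
    have "b * b' * x = t * (t * x + a * y) - a * (x + t * y)"
         "b * b' * y = t * (x + t * y) - (t * x + a * y)"
      unfolding a by (simp_all add: algebra_simps power2_eq_square)
    with 0 have "b * b' * x = 0" "b * b' * y = 0" "b' * z = 0" by simp_all
    with bb(2) have "x = 0" "y = 0" "z = 0" by (metis mult_eq_0_iff)+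
    with sol(1) show False by simp
  qed
  ultimately show ?thesis
    using sol(2) unfolding conic_soluble_def by (metis mult_zero_right)
qed

section \<open>The local-global principle for conics\<close>

text \<open>
  A common factor \<open>p\<close> of a solution modulo \<open>p\<^sup>n\<close> can be divided out at the cost of passing to
  \<open>p\<^sup>n\<^sup>-\<^sup>2\<close>. Fewer than \<open>C\<close> such steps are possible, so starting with \<open>n = 2 C + 2\<close> leaves at least \<open>p\<^sup>2\<close>.
\<close>

lemma primitive_solution_mod_square:
  assumes p: "prime p" and sol: "conic_soluble_at p a b"
  obtains x y z where "\<not> (int p dvd x \<and> int p dvd y \<and> int p dvd z)"
    "(int p)\<^sup>2 dvd x\<^sup>2 - a * y\<^sup>2 - b * z\<^sup>2"
proof -
  from sol obtain C where C: "\<And>n. \<exists>x y z. \<not> (int p ^ C dvd x \<and> int p ^ C dvd y \<and> int p ^ C dvd z) \<and>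
        int p ^ n dvd x\<^sup>2 - a * y\<^sup>2 - b * z\<^sup>2"
    by (auto simp: conic_soluble_at_def)
  from C[of "2 * C + 2"] obtain x y z where
    xyz: "\<not> (int p ^ C dvd x \<and> int p ^ C dvd y \<and> int p ^ C dvd z)"
      "int p ^ (2 * C + 2) dvd x\<^sup>2 - a * y\<^sup>2 - b * z\<^sup>2" by blast
  have "\<exists>x y z. \<not> (int p dvd x \<and> int p dvd y \<and> int p dvd z) \<and>
      (int p)\<^sup>2 dvd x\<^sup>2 - a * y\<^sup>2 - b * z\<^sup>2"
    using xyz
  proof (induction C arbitrary: x y z)
    case 0
    thus ?case by simp
  next
    case (Suc C)
    show ?case
    proof (cases "int p dvd x \<and> int p dvd y \<and> int p dvd z")
      case True
      then obtain x' y' z' where *: "x = int p * x'" "y = int p * y'" "z = int p * z'"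
        by (auto elim!: dvdE)
      have p0: "int p \<noteq> 0" using p by (simp add: prime_gt_0_nat)
      have "int p ^ 2 * int p ^ (2 * C + 2) dvd int p ^ 2 * (x'\<^sup>2 - a * y'\<^sup>2 - b * z'\<^sup>2)"
        using Suc.prems(2) unfolding *
        by (simp add: algebra_simps power_mult_distrib power_add power2_eq_square)
      hence "int p ^ (2 * C + 2) dvd x'\<^sup>2 - a * y'\<^sup>2 - b * z'\<^sup>2"
        using p0 by (subst (asm) dvd_mult_cancel_left) auto
      moreover have "\<not> (int p ^ C dvd x' \<and> int p ^ C dvd y' \<and> int p ^ C dvd z')"
        using Suc.prems(1) p0 unfolding * by auto
      ultimately show ?thesis using Suc.IH by blast
    next
      case False
      moreover have "(int p)\<^sup>2 dvd int p ^ (2 * Suc C + 2)"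
        by (intro le_imp_power_dvd) simp
      ultimately show ?thesis using Suc.prems(2) dvd_trans by blast
    qed
  qed
  thus ?thesis using that by blast
qed

text \<open>
  Modulo \<open>p\<close> the equation becomes \<open>x\<^sup>2 = a y\<^sup>2\<close>, which shows that \<open>a\<close> is a square unless \<open>p\<close>
  divides \<open>y\<close>. In that case \<open>p\<close> divides \<open>x\<close>, hence \<open>p\<^sup>2\<close> divides \<open>b z\<^sup>2\<close> with \<open>z\<close> prime to \<open>p\<close> by
  primitivity, against the assumption that \<open>p\<close> divides \<open>b\<close> only once.
\<close>

lemma square_mod_prime_of_conic:
  assumes p: "prime p" and sol: "conic_soluble_at p a b"
    and pb: "int p dvd b" "\<not> (int p)\<^sup>2 dvd b"
  shows "\<exists>t. int p dvd t\<^sup>2 - a"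
proof -
  have P: "prime (int p)" using p by simp
  obtain x y z where xyz: "\<not> (int p dvd x \<and> int p dvd y \<and> int p dvd z)"
    "(int p)\<^sup>2 dvd x\<^sup>2 - a * y\<^sup>2 - b * z\<^sup>2"
    using primitive_solution_mod_square[OF p sol] .
  have "int p dvd x\<^sup>2 - a * y\<^sup>2 - b * z\<^sup>2"
    using xyz(2) by (metis dvd_mult_left power2_eq_square)
  hence xy: "int p dvd x\<^sup>2 - a * y\<^sup>2"
    using pb(1) by (metis dvd_diff_right_iff dvd_mult2 dvd_diff_left_iff)
  have y: "\<not> int p dvd y"
  proof
    assume y: "int p dvd y"
    hence "int p dvd x\<^sup>2"
      using xy by (metis dvd_diff_left_iff dvd_mult dvd_power_iff_le dvd_trans dvd_refl power2_eq_square dvd_mult2)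
    hence x: "int p dvd x" using P prime_dvd_power by blast
    have "(int p)\<^sup>2 dvd x\<^sup>2 - a * y\<^sup>2"
      using x y by (intro dvd_diff dvd_mult dvd_power_same)
    hence "(int p)\<^sup>2 dvd b * z\<^sup>2"
      using xyz(2) by (metis dvd_diff_right_iff)
    moreover have "coprime ((int p)\<^sup>2) (z\<^sup>2)"
      using xyz(1) x y P by (simp add: prime_imp_coprime)
    ultimately show False
      using pb(2) by (simp add: coprime_dvd_mult_left_iff)
  qed
  hence "coprime y (int p)" using P by (metis coprime_commute prime_imp_coprime)
  then obtain w where w: "[y * w = 1] (mod int p)" using cong_solve_coprime_int by blast
  have "[(x * w)\<^sup>2 = x\<^sup>2 * w\<^sup>2] (mod int p)" by (simp add: power_mult_distrib)
  also have "[x\<^sup>2 * w\<^sup>2 = (a * y\<^sup>2) * w\<^sup>2] (mod int p)"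
    using xy by (intro cong_mult cong_refl) (simp add: cong_iff_dvd_diff)
  also have "(a * y\<^sup>2) * w\<^sup>2 = a * (y * w)\<^sup>2" by (simp add: power_mult_distrib)
  also have "[a * (y * w)\<^sup>2 = a * 1\<^sup>2] (mod int p)"
    using w by (intro cong_mult cong_refl cong_pow)
  finally show ?thesis by (auto simp: cong_iff_dvd_diff)
qed

lemma square_mod_squarefree:
  fixes a b :: int
  assumes "squarefree b" "\<And>p. prime p \<Longrightarrow> p dvd b \<Longrightarrow> \<exists>t. p dvd t\<^sup>2 - a"
  shows "\<exists>t. b dvd t\<^sup>2 - a"
proof -
  have "b \<noteq> 0" using assms(1) by auto
  thus ?thesis using assms
  proof (induction b rule: prime_divisors_induct)
    case (factor p b)
    have "squarefree b" using factor.prems(2) squarefree_multD(2) by blast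
    moreover have "\<exists>t. q dvd t\<^sup>2 - a" if "prime q" "q dvd b" for q
      using factor.prems(3) that by simp
    ultimately obtain t where t: "b dvd t\<^sup>2 - a" using factor by auto
    obtain s where s: "p dvd s\<^sup>2 - a" using factor.prems(3)[of p] factor.hyps by auto
    have cop: "coprime p b"
      using factor by (metis dvd_triv_left mult_dvd_mono dvd_refl not_prime_unit power2_eq_square
          prime_imp_coprime squarefreeD)
    then obtain x where x: "[x = s] (mod p)" "[x = t] (mod b)"
      using binary_chinese_remainder_int by blast
    have "[x\<^sup>2 = a] (mod p)"
      using cong_pow[OF x(1), of 2] s by (metis cong_iff_dvd_diff cong_trans)
    moreover have "[x\<^sup>2 = a] (mod b)"
      using cong_pow[OF x(2), of 2] t by (metis cong_iff_dvd_diff cong_trans)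
    ultimately have "p * b dvd x\<^sup>2 - a"
      using cop by (simp add: cong_iff_dvd_diff divides_mult)
    thus ?case by blast
  next
    case (unit b)
    thus ?case by (meson dvd_trans one_dvd)
  qed simp
qed

lemma small_square_root_mod:
  fixes a b :: int
  assumes "b dvd s\<^sup>2 - a" "b \<noteq> 0"
  obtains t where "b dvd t\<^sup>2 - a" "2 * \<bar>t\<bar> \<le> \<bar>b\<bar>"
proof
  define B where "B = \<bar>b\<bar>"
  \<comment> \<open>the residue of \<open>s\<close> of least absolute value\<close>
  define t where "t = (s + B div 2) mod B - B div 2"
  have B: "B > 0" using assms by (simp add: B_def)
  have "0 \<le> (s + B div 2) mod B" "(s + B div 2) mod B < B" using B by simp_all
  moreover have "2 * (B div 2) \<le> B" "B \<le> 2 * (B div 2) + 1" by simp_all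
  moreover have "2 * \<bar>u - h\<bar> \<le> B"
    if "0 \<le> u" "u < B" "2 * h \<le> B" "B \<le> 2 * h + 1" for u h
    using that by (simp add: abs_if)
  ultimately show "2 * \<bar>t\<bar> \<le> \<bar>b\<bar>" unfolding B_def[symmetric] t_def by blast
  have "[t = (s + B div 2) - B div 2] (mod B)"
    unfolding t_def by (intro cong_diff cong_refl) (simp add: cong_def)
  hence "[t\<^sup>2 = s\<^sup>2] (mod B)" by (intro cong_pow) simp
  hence "b dvd t\<^sup>2 - s\<^sup>2" by (simp add: cong_iff_dvd_diff B_def)
  from dvd_add[OF this assms(1)] show "b dvd t\<^sup>2 - a" by simp
qed

text \<open>
  The theorem of Legendre, by descent on \<open>\<bar>a\<bar> + \<bar>b\<bar>\<close>. By symmetry \<open>\<bar>a\<bar> \<le> \<bar>b\<bar>\<close>, and square factors of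
  \<open>b\<close> go into \<open>z\<close>. For squarefree \<open>b\<close>, write \<open>t\<^sup>2 - a = b b'\<close> with \<open>\<bar>t\<bar> \<le> \<bar>b\<bar> / 2\<close>; then
  \<open>\<bar>b'\<bar> \<le> \<bar>b\<bar> / 4 + 1 < \<bar>b\<bar>\<close> once \<open>\<bar>b\<bar> \<ge> 2\<close>. The local conditions, including the sign condition,
  pass from \<open>(a, b)\<close> to \<open>(a, b')\<close>, and the solution found for \<open>(a, b')\<close> passes back.
\<close>

lemma conic_local_global:
  fixes a b :: int
  assumes "a \<noteq> 0" "b \<noteq> 0" "a > 0 \<or> b > 0" "\<And>p. prime p \<Longrightarrow> conic_soluble_at p a b"
  shows "conic_soluble a b"
  using assms
proof (induction "nat (\<bar>a\<bar> + \<bar>b\<bar>)" arbitrary: a b rule: less_induct)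
  case (less a b)
  have main: "conic_soluble a b"
    if "\<bar>a\<bar> \<le> \<bar>b\<bar>" and nz: "a \<noteq> 0" "b \<noteq> 0" and pos: "a > 0 \<or> b > 0"
      and loc: "\<And>p. prime p \<Longrightarrow> conic_soluble_at p a b"
      and IH: "\<And>b'. \<bar>b'\<bar> < \<bar>b\<bar> \<Longrightarrow> b' \<noteq> 0 \<Longrightarrow> a > 0 \<or> b' > 0 \<Longrightarrow>
                 (\<And>p. prime p \<Longrightarrow> conic_soluble_at p a b') \<Longrightarrow> conic_soluble a b'"
    for a b :: int
  proof (cases "squarefree b")
    case False
    then obtain k where k: "k\<^sup>2 dvd b" "\<not> k dvd 1" by (auto simp: squarefree_def)
    then obtain b' where b': "b = k\<^sup>2 * b'" by auto
    have k0: "k \<noteq> 0" and b0: "b' \<noteq> 0" using nz b' by auto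
    have "\<bar>k\<bar> \<ge> 2" using k(2) k0 by (metis abs_dvd_iff dvd_refl int_one_le_iff_zero_less
          linorder_neqE_linordered_idom not_le zero_less_abs_iff one_add_one add1_zle_eq)
    hence "k\<^sup>2 \<ge> 2\<^sup>2" using abs_le_square_iff[of 2 k] by simp
    hence k1: "k\<^sup>2 > 1" by simp
    have "\<bar>b\<bar> = k\<^sup>2 * \<bar>b'\<bar>" by (simp add: b' abs_mult)
    hence "\<bar>b'\<bar> < \<bar>b\<bar>" using k1 b0 by simp
    moreover have "a > 0 \<or> b' > 0"
      using pos k1 unfolding b' by (metis zero_less_mult_pos zero_less_one less_trans)
    moreover have "conic_soluble_at p a b'" if "prime p" for p
      using conic_soluble_at_square_factor[OF that k0] loc[OF that] unfolding b' by blast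
    ultimately have "conic_soluble a b'"
      using b0 by (intro IH)
    thus ?thesis unfolding b' by (rule conic_soluble_square_factor[OF k0])
  next
    case True
    show ?thesis
    proof (cases "\<bar>b\<bar> = 1")
      case True
      hence "a = 1 \<or> b = 1" using that(1) nz pos by auto
      moreover have "conic_soluble 1 b"
        unfolding conic_soluble_def by (intro exI[of _ 1] exI[of _ 0]) simp
      moreover have "conic_soluble a 1"
        unfolding conic_soluble_def by (rule exI[of _ 1], rule exI[of _ 0], rule exI[of _ 1]) simp
      ultimately show ?thesis by auto
    next
      case False
      hence b2: "\<bar>b\<bar> \<ge> 2" using nz by linarith
      have "\<exists>t. q dvd t\<^sup>2 - a" if q: "prime q" "q dvd b" for q :: int
      proof -
        obtain p where p: "q = int p" "prime p"
          using q(1) by (metis nonneg_int_cases prime_ge_0_int prime_int_nat_transfer nat_int)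
        moreover have "\<not> q\<^sup>2 dvd b"
          using True q by (meson not_prime_unit squarefreeD)
        ultimately show ?thesis
          using square_mod_prime_of_conic[OF p(2) loc[OF p(2)]] q(2) by simp
      qed
      then obtain s where "b dvd s\<^sup>2 - a" using square_mod_squarefree[OF True] by blast
      then obtain t where t: "b dvd t\<^sup>2 - a" "2 * \<bar>t\<bar> \<le> \<bar>b\<bar>"
        using nz small_square_root_mod by blast
      then obtain b' where b': "b * b' = t\<^sup>2 - a" by (metis dvdE)
      show ?thesis
      \<comment> \<open>\<open>b' = 0\<close> means \<open>a = t\<^sup>2\<close>, and then \<open>(t, 1, 0)\<close> is a point\<close>
      proof (cases "b' = 0")
        case True
        thus ?thesis using b' unfolding conic_soluble_def
          by (intro exI[of _ t] exI[of _ 1] exI[of _ 0]) auto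
      next
        case nz': False
        have "(2 * \<bar>t\<bar>)\<^sup>2 \<le> \<bar>b\<bar>\<^sup>2" using t(2) by (intro power_mono) auto
        hence t4: "4 * t\<^sup>2 \<le> \<bar>b\<bar> * \<bar>b\<bar>" by (simp add: power2_eq_square)
        have "\<bar>b\<bar> * \<bar>b'\<bar> = \<bar>t\<^sup>2 - a\<bar>" using b' by (metis abs_mult)
        also have "\<dots> \<le> t\<^sup>2 + \<bar>a\<bar>" using zero_le_power2[of t] by linarith
        finally have "4 * (\<bar>b\<bar> * \<bar>b'\<bar>) \<le> \<bar>b\<bar> * \<bar>b\<bar> + 4 * \<bar>b\<bar>"
          using t4 that(1) by linarith
        hence "\<bar>b\<bar> * (4 * \<bar>b'\<bar>) \<le> \<bar>b\<bar> * (\<bar>b\<bar> + 4)" by (simp add: algebra_simps)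
        hence "4 * \<bar>b'\<bar> \<le> \<bar>b\<bar> + 4" using nz by (simp add: mult_le_cancel_left)
        hence lt: "\<bar>b'\<bar> < \<bar>b\<bar>" using b2 by linarith
        have pos': "a > 0 \<or> b' > 0"
        proof (cases "a > 0")
          case False
          hence "b > 0" "b * b' > 0" using pos nz b' zero_le_power2[of t] by linarith+
          thus ?thesis by (simp add: zero_less_mult_iff)
        qed simp
        have bb: "b * b' \<noteq> 0" using nz nz' by simp
        have "conic_soluble a b'"
          using IH[OF lt nz' pos'] conic_soluble_at_norm[OF _ b' bb] loc by blast
        thus ?thesis using conic_soluble_norm[OF b' bb] by blast
      qed
    qed
  qed
  show ?case
  proof (cases "\<bar>a\<bar> \<le> \<bar>b\<bar>")
    case True
    show ?thesis
      by (rule main[OF True less.prems]) (use less.prems(1) in \<open>auto intro!: less.hyps\<close>)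
  next
    case False
    have "conic_soluble b a"
    proof (rule main)
      fix b' :: int
      assume "\<bar>b'\<bar> < \<bar>a\<bar>" "b' \<noteq> 0" "b > 0 \<or> b' > 0" "\<And>p. prime p \<Longrightarrow> conic_soluble_at p b b'"
      thus "conic_soluble b b'" using less.prems(2) by (intro less.hyps) auto
    qed (use False less.prems in \<open>auto simp: conic_soluble_at_commute[of _ b a]\<close>)
    thus ?thesis by (simp add: conic_soluble_commute)
  qed
qed

section \<open>Values of forms and completion of a column\<close>

fun bqf_value :: "'a::comm_ring_1 bqf \<Rightarrow> 'a \<Rightarrow> 'a \<Rightarrow> 'a" where
  "bqf_value (BQF l m r) x y = l * x\<^sup>2 + m * x * y + r * y\<^sup>2"

text \<open>
  Twice the symmetric bilinear form of \<open>Q\<close>: the middle coefficient of \<open>Q\<close> in the basis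
  \<open>(x, y)\<close>, \<open>(x', y')\<close>.
\<close>

fun bqf_polar :: "'a::comm_ring_1 bqf \<Rightarrow> 'a \<Rightarrow> 'a \<Rightarrow> 'a \<Rightarrow> 'a \<Rightarrow> 'a" where
  "bqf_polar (BQF l m r) x y x' y' = 2 * l * x * x' + m * (x * y' + x' * y) + 2 * r * y * y'"

lemma bqf_value_scale: "bqf_value Q (k * x) (k * y) = k\<^sup>2 * bqf_value Q x y"
  by (cases Q) (simp add: algebra_simps power2_eq_square)

lemma bqf_value_linear_combination:
  "bqf_value Q (a * x + b * y) (c * x + d * y) =
     bqf_value Q a c * x\<^sup>2 + bqf_polar Q a c b d * x * y + bqf_value Q b d * y\<^sup>2"
  by (cases Q) (simp add: algebra_simps power2_eq_square)

lemma bqf_polar_linear_combination: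
  "bqf_polar Q (a * x + b * y) (c * x + d * y) (a * x' + b * y') (c * x' + d * y') =
     2 * bqf_value Q a c * x * x' + bqf_polar Q a c b d * (x * y' + x' * y) +
     2 * bqf_value Q b d * y * y'"
  by (cases Q) (simp add: algebra_simps power2_eq_square)

lemma discriminant_transform:
  "(bqf_polar Q a c b d)\<^sup>2 - 4 * bqf_value Q a c * bqf_value Q b d =
     (a * d - b * c)\<^sup>2 * bqf_discriminant Q"
  by (cases Q) (simp add: algebra_simps power2_eq_square)

lemma discriminant_eq_imp_half_difference:
  assumes "bqf_discriminant (BQF l m r) = bqf_discriminant (BQF l' m' r')"
  obtains h where "m' = m + 2 * h" "h * (h + m) + l * r = l' * r'"
proof -
  have eq: "m\<^sup>2 - 4 * l * r = m'\<^sup>2 - 4 * l' * r'" using assms by simp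
  have "even (m\<^sup>2 - 4 * l * r) = even (m'\<^sup>2 - 4 * l' * r')" using eq by simp
  hence "even (m' - m)" by simp
  then obtain h where "m' - m = 2 * h" by (elim evenE)
  hence h: "m' = m + 2 * h" by simp
  from eq have "4 * (h * (h + m) + l * r) = 4 * (l' * r')"
    unfolding h by (simp add: algebra_simps power2_eq_square)
  thus ?thesis using that h by simp
qed

text \<open>
  The column \<open>(b, d)\<close> is the solution of two linear equations: determinant \<open>1\<close> and the
  prescribed middle coefficient \<open>m' = m + 2 h\<close>. The determinant of this system is \<open>- 2 N\<close>, but as
  \<open>m\<close> and \<open>m'\<close> have the same parity the factor \<open>2\<close> cancels, so that only an inverse \<open>v\<close> of \<open>N\<close> is
  needed and the prime \<open>2\<close> requires no special treatment. As \<open>v\<close> is arbitrary here, the identities can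
  be read in a ring where \<open>v N = 1\<close> as well as modulo an integer.
\<close>

lemma second_column:
  fixes l m r a c h v k N :: "'a::comm_ring_1"
  assumes N: "bqf_value (BQF l m r) a c = N" and k: "h * (h + m) + l * r = k"
    and b: "b = v * (a * h - r * c)" and d: "d = v * (c * (h + m) + l * a)"
  shows "a * d - b * c = v * N"
    and "bqf_polar (BQF l m r) a c b d = v * N * (m + 2 * h)"
    and "bqf_value (BQF l m r) b d = v * (v * N) * k"
  unfolding N[symmetric] k[symmetric] b d by (simp_all add: algebra_simps power2_eq_square)

section \<open>Equivalence over the rationals and the reals\<close>

lemma int_embed_type_algebra:
  "[k] \<cdot>\<^bsub>(ring_of_type_algebra :: 'a::comm_ring_1 ring)\<^esub> \<one>\<^bsub>(ring_of_type_algebra :: 'a ring)\<^esub> = of_int k"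
proof -
  let ?R = "ring_of_type_algebra :: 'a ring"
  interpret R: cring ?R by (rule cring_from_type_algebra)
  have nat: "[n] \<cdot>\<^bsub>?R\<^esub> \<one>\<^bsub>?R\<^esub> = of_nat n" for n :: nat
    by (induction n) (simp_all add: R.add.nat_pow_Suc, simp_all add: ring_of_type_algebra_def)
  have neg: "\<ominus>\<^bsub>?R\<^esub> x = - x" for x
    by (rule R.minus_equality) (simp_all add: ring_of_type_algebra_def)
  show ?thesis
    by (cases "k \<ge> 0") (simp_all add: add_pow_int_ge add_pow_int_lt nat neg)
qed

lemma SL2_equivalent_type_algebra_iff:
  "SL2_equivalent (ring_of_type_algebra :: 'a::comm_ring_1 ring) Q (BQF l' m' r') \<longleftrightarrow>
     (\<exists>a b c d. a * d - b * c = 1 \<and> bqf_value (map_bqf of_int Q) a c = (of_int l' :: 'a) \<and>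
        bqf_polar (map_bqf of_int Q) a c b d = of_int m' \<and> bqf_value (map_bqf of_int Q) b d = of_int r')"
proof -
  let ?R = "ring_of_type_algebra :: 'a ring"
  interpret R: cring ?R by (rule cring_from_type_algebra)
  have neg: "\<ominus>\<^bsub>?R\<^esub> x = - x" for x
    by (rule R.minus_equality) (simp_all add: ring_of_type_algebra_def)
  have base: "bqf_base_change ?R F = map_bqf of_int F" for F
    by (simp add: bqf_base_change_def int_embed_type_algebra)
  have subst: "bqf_subst ?R F (a, b, c, d) =
      BQF (bqf_value F a c) (bqf_polar F a c b d) (bqf_value F b d)" for F a b c d
    by (cases F) (simp add: ring_of_type_algebra_def algebra_simps power2_eq_square)
  have SL2: "SL2 ?R = {(a, b, c, d). a * d - b * c = 1}"
    by (simp add: SL2_def a_minus_def neg) (simp add: ring_of_type_algebra_def)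
  show ?thesis
    unfolding SL2_equivalent_def base SL2 by (auto simp: subst)
qed

lemma SL2_equivalent_rat_imp_real:
  assumes "SL2_equivalent (ring_of_type_algebra :: rat ring) Q Q'"
  shows "SL2_equivalent (ring_of_type_algebra :: real ring) Q Q'"
proof -
  obtain l m r l' m' r' where Q: "Q = BQF l m r" "Q' = BQF l' m' r'" by (metis bqf.exhaust)
  from assms obtain a b c d where *:
      "a * d - b * c = 1" "bqf_value (map_bqf of_int Q) a c = (of_int l' :: rat)"
      "bqf_polar (map_bqf of_int Q) a c b d = of_int m'"
      "bqf_value (map_bqf of_int Q) b d = of_int r'"
    unfolding Q(2) SL2_equivalent_type_algebra_iff by blast
  note ** = *[THEN arg_cong[of _ _ "of_rat :: rat \<Rightarrow> real"]]
  show ?thesis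
    using ** unfolding Q(2) SL2_equivalent_type_algebra_iff
    by (intro exI[of _ "of_rat a"] exI[of _ "of_rat b"] exI[of _ "of_rat c"] exI[of _ "of_rat d"])
       (simp add: Q(1) of_rat_add of_rat_diff of_rat_mult of_rat_power)
qed

lemma Q_equivalent_if_represents:
  assumes disc: "bqf_discriminant Q = bqf_discriminant (BQF l' m' r')" and l': "l' \<noteq> 0"
    and rep: "bqf_value (map_bqf of_int Q) a c = (of_int l' :: rat)"
  shows "Q_equivalent Q (BQF l' m' r')"
proof -
  obtain l m r where Q: "Q = BQF l m r" by (cases Q)
  obtain h where h: "m' = m + 2 * h" "h * (h + m) + l * r = l' * r'"
    using discriminant_eq_imp_half_difference disc unfolding Q by blast
  have h': "of_int h * (of_int h + of_int m) + of_int l * of_int r = (of_int (l' * r') :: rat)"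
    unfolding h(2)[symmetric] by simp
  have rep': "bqf_value (BQF (of_int l) (of_int m) (of_int r)) a c = (of_int l' :: rat)"
    using rep by (simp only: Q bqf.map)
  define b where "b = 1 / of_int l' * (a * of_int h - of_int r * c)"
  define d where "d = 1 / of_int l' * (c * (of_int h + of_int m) + of_int l * a)"
  note col = second_column[OF rep' h' b_def d_def]
  show ?thesis
    unfolding Q_equivalent_def SL2_equivalent_type_algebra_iff
    using col rep' l'
    by (intro exI[of _ a] exI[of _ b] exI[of _ c] exI[of _ d])
       (simp add: Q h(1) del: bqf_value.simps bqf_polar.simps)
qed

lemma common_denominator:
  obtains n k w :: int where "w \<noteq> 0" "(x :: rat) = of_int n / of_int w" "(y :: rat) = of_int k / of_int w"
proof -
  obtain a b where a: "x = of_int a / of_int b" "b \<noteq> 0"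
    by (cases x) (metis Fract_of_int_quotient less_irrefl)
  obtain c d where c: "y = of_int c / of_int d" "d \<noteq> 0"
    by (cases y) (metis Fract_of_int_quotient less_irrefl)
  show ?thesis by (rule that[of "b * d" "a * d" "c * b"]) (use a c in auto)
qed

text \<open>
  The values that \<open>Q'\<close> takes at integral vectors are represented by \<open>Q\<close> over \<open>\<rat>\<close>; the number \<open>w\<close> is a
  common denominator of the representing vector.
\<close>

lemma Q_equivalent_imp_represents:
  assumes "Q_equivalent Q Q'"
  obtains x y w where "bqf_value Q x y = bqf_value Q' s t * w\<^sup>2" "w \<noteq> 0"
proof -
  obtain l m r where Q: "Q = BQF l m r" by (cases Q)
  obtain l' m' r' where Q': "Q' = BQF l' m' r'" by (cases Q')
  from assms obtain a b c d :: rat where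
      "bqf_value (map_bqf of_int Q) a c = of_int l'"
      "bqf_polar (map_bqf of_int Q) a c b d = of_int m'"
      "bqf_value (map_bqf of_int Q) b d = of_int r'"
    unfolding Q_equivalent_def Q' SL2_equivalent_type_algebra_iff by blast
  hence *: "bqf_value (map_bqf of_int Q) (a * of_int s + b * of_int t) (c * of_int s + d * of_int t) =
      of_int (bqf_value Q' s t)"
    unfolding bqf_value_linear_combination by (simp add: Q')
  obtain x y w where w: "w \<noteq> 0" "a * of_int s + b * of_int t = of_int x / of_int w"
      "c * of_int s + d * of_int t = of_int y / of_int w"
    using common_denominator .
  have "of_int (bqf_value Q x y) = (of_int w)\<^sup>2 * (of_int (bqf_value Q' s t) :: rat)"
    using w(1) unfolding *[symmetric] w(2,3) by (simp add: Q field_simps power2_eq_square)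
  hence "of_int (bqf_value Q x y) = (of_int (bqf_value Q' s t * w\<^sup>2) :: rat)" by simp
  hence "bqf_value Q x y = bqf_value Q' s t * w\<^sup>2" by (simp only: of_int_eq_iff)
  thus ?thesis using that w(1) by blast
qed

section \<open>Equivalence over the p-adic integers\<close>

lemma padic_ints_simps:
  "u \<otimes>\<^bsub>padic_ints p\<^esub> v = (\<lambda>n. (u n * v n) mod int p ^ n)"
  "u \<oplus>\<^bsub>padic_ints p\<^esub> v = (\<lambda>n. (u n + v n) mod int p ^ n)"
  "\<one>\<^bsub>padic_ints p\<^esub> = (\<lambda>n. 1 mod int p ^ n)" "\<zero>\<^bsub>padic_ints p\<^esub> = (\<lambda>n. 0)"
  by (simp_all add: padic_ints_def)

lemma padic_ints_uminus:
  assumes "p > 0" "u \<in> carrier (padic_ints p)"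
  shows "\<ominus>\<^bsub>padic_ints p\<^esub> u = (\<lambda>n. (- u n) mod int p ^ n)"
proof -
  interpret cring "padic_ints p" using cring_padic_ints[OF assms(1)] .
  have "(\<lambda>n. (- u n) mod int p ^ n) \<in> carrier (padic_ints p)"
    using padic_ints_cong[OF assms(2)]
    by (intro padic_ints_of_seq[OF assms(1)]) (simp add: cong_minus_minus_iff)
  thus ?thesis
    using assms(2) by (intro minus_equality) (simp_all add: padic_ints_simps mod_simps)
qed

lemma int_embed_padic_ints:
  assumes "p > 0"
  shows "[k] \<cdot>\<^bsub>padic_ints p\<^esub> \<one>\<^bsub>padic_ints p\<^esub> = (\<lambda>n. k mod int p ^ n)"
proof -
  interpret cring "padic_ints p" using cring_padic_ints[OF assms(1)] .
  have nat: "[n] \<cdot>\<^bsub>padic_ints p\<^esub> \<one>\<^bsub>padic_ints p\<^esub> = (\<lambda>i. int n mod int p ^ i)" for n :: nat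
    by (induction n) (simp_all add: add.nat_pow_Suc, simp_all add: padic_ints_simps mod_simps add.commute)
  show ?thesis
  proof (cases "k \<ge> 0")
    case True
    thus ?thesis by (simp add: add_pow_int_ge nat)
  next
    case False
    have "(\<lambda>i. (- k) mod int p ^ i) \<in> carrier (padic_ints p)"
      by (intro padic_ints_of_seq[OF assms]) simp
    from padic_ints_uminus[OF assms this] show ?thesis
      using False by (simp add: add_pow_int_lt nat mod_simps)
  qed
qed

text \<open>
  The matrix is an element of \<open>SL\<^sub>2(\<int>/N)\<close> that carries the reduction of the first form to that of the
  second.
\<close>

fun transforms_mod :: "int \<Rightarrow> int bqf \<Rightarrow> int bqf \<Rightarrow> int \<times> int \<times> int \<times> int \<Rightarrow> bool" where
  "transforms_mod N Q (BQF l' m' r') (a, b, c, d) \<longleftrightarrow>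
     [a * d - b * c = 1] (mod N) \<and> [bqf_value Q a c = l'] (mod N) \<and>
     [bqf_polar Q a c b d = m'] (mod N) \<and> [bqf_value Q b d = r'] (mod N)"

lemma transforms_mod_trans:
  assumes "transforms_mod N Q Q' (a, b, c, d)" "transforms_mod N Q' Q'' (x, x', y, y')"
  shows "transforms_mod N Q Q'' (a * x + b * y, a * x' + b * y', c * x + d * y, c * x' + d * y')"
proof -
  obtain l m r where Q': "Q' = BQF l m r" by (cases Q')
  obtain l' m' r' where Q'': "Q'' = BQF l' m' r'" by (cases Q'')
  have A: "[a * d - b * c = 1] (mod N)" "[bqf_value Q a c = l] (mod N)"
      "[bqf_polar Q a c b d = m] (mod N)" "[bqf_value Q b d = r] (mod N)"
    using assms(1) by (simp_all add: Q')
  have B: "[x * y' - x' * y = 1] (mod N)" "[bqf_value Q' x y = l'] (mod N)"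
      "[bqf_polar Q' x y x' y' = m'] (mod N)" "[bqf_value Q' x' y' = r'] (mod N)"
    using assms(2) by (simp_all add: Q'')
  have val: "[bqf_value Q (a * s + b * t) (c * s + d * t) = bqf_value Q' s t] (mod N)" for s t
    unfolding bqf_value_linear_combination Q' bqf_value.simps by (intro cong_add cong_mult cong_refl A)
  have pol: "[bqf_polar Q (a * x + b * y) (c * x + d * y) (a * x' + b * y') (c * x' + d * y') =
      bqf_polar Q' x y x' y'] (mod N)"
    unfolding bqf_polar_linear_combination Q' bqf_polar.simps by (intro cong_add cong_mult cong_refl A)
  have "(a * x + b * y) * (c * x' + d * y') - (a * x' + b * y') * (c * x + d * y) =
      (a * d - b * c) * (x * y' - x' * y)" by (simp add: algebra_simps)
  also have "[\<dots> = 1 * 1] (mod N)" by (intro cong_mult A B)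
  finally have "[(a * x + b * y) * (c * x' + d * y') - (a * x' + b * y') * (c * x + d * y) = 1] (mod N)"
    by simp
  thus ?thesis
    unfolding Q'' transforms_mod.simps
    using cong_trans[OF val B(2)] cong_trans[OF pol B(3)] cong_trans[OF val B(4)] by blast
qed

lemma transforms_mod_cong:
  assumes "[a = a'] (mod N)" "[b = b'] (mod N)" "[c = c'] (mod N)" "[d = d'] (mod N)"
    and "transforms_mod N Q Q' (a, b, c, d)"
  shows "transforms_mod N Q Q' (a', b', c', d')"
proof -
  obtain l m r where Q: "Q = BQF l m r" by (cases Q)
  obtain l' m' r' where Q': "Q' = BQF l' m' r'" by (cases Q')
  have "[a' * d' - b' * c' = a * d - b * c] (mod N)"
    by (intro cong_diff cong_mult assms(1-4)[THEN cong_sym])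
  moreover have "[bqf_value Q a' c' = bqf_value Q a c] (mod N)"
    unfolding Q bqf_value.simps by (intro cong_add cong_mult cong_pow cong_refl assms(1-4)[THEN cong_sym])
  moreover have "[bqf_polar Q a' c' b' d' = bqf_polar Q a c b d] (mod N)"
    unfolding Q bqf_polar.simps by (intro cong_add cong_mult cong_pow cong_refl assms(1-4)[THEN cong_sym])
  moreover have "[bqf_value Q b' d' = bqf_value Q b d] (mod N)"
    unfolding Q bqf_value.simps by (intro cong_add cong_mult cong_pow cong_refl assms(1-4)[THEN cong_sym])
  ultimately show ?thesis
    using assms(5) unfolding Q' transforms_mod.simps by (meson cong_trans)
qed

lemma SL2_equivalent_padic_iff:
  assumes p: "p > 0"
  shows "SL2_equivalent (padic_ints p) Q Q' \<longleftrightarrow>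
    (\<exists>a b c d. {a, b, c, d} \<subseteq> carrier (padic_ints p) \<and>
       (\<forall>n. transforms_mod (int p ^ n) Q Q' (a n, b n, c n, d n)))"
proof -
  interpret cring "padic_ints p" using cring_padic_ints[OF p] .
  obtain l m r where Q: "Q = BQF l m r" by (cases Q)
  obtain l' m' r' where Q': "Q' = BQF l' m' r'" by (cases Q')
  have base: "bqf_base_change (padic_ints p) F = map_bqf (\<lambda>k n. k mod int p ^ n) F" for F
    by (simp add: bqf_base_change_def int_embed_padic_ints[OF p])
  have val: "bqf_eval (padic_ints p) (bqf_base_change (padic_ints p) Q) x y =
      (\<lambda>n. bqf_value Q (x n) (y n) mod int p ^ n)" for x y
    by (simp add: Q base padic_ints_simps mod_simps power2_eq_square mult.assoc)
  have subst: "bqf_subst (padic_ints p) (bqf_base_change (padic_ints p) Q) (a, b, c, d) =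
      BQF (\<lambda>n. bqf_value Q (a n) (c n) mod int p ^ n)
          (\<lambda>n. bqf_polar Q (a n) (c n) (b n) (d n) mod int p ^ n)
          (\<lambda>n. bqf_value Q (b n) (d n) mod int p ^ n)" for a b c d
  proof -
    have "(\<lambda>n. bqf_polar Q (a n) (c n) (b n) (d n) mod int p ^ n) =
      (\<lambda>n. (l * (a n * b n) + l * (a n * b n) + m * (a n * d n + b n * c n) +
          (r * (c n * d n) + r * (c n * d n))) mod int p ^ n)"
      by (simp add: Q algebra_simps)
    thus ?thesis
      unfolding val[symmetric] by (simp add: Q base padic_ints_simps mod_simps)
  qed
  have det: "(a \<otimes>\<^bsub>padic_ints p\<^esub> d \<ominus>\<^bsub>padic_ints p\<^esub> b \<otimes>\<^bsub>padic_ints p\<^esub> c = \<one>\<^bsub>padic_ints p\<^esub>) \<longleftrightarrow>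
      (\<forall>n. [a n * d n - b n * c n = 1] (mod int p ^ n))"
    if "a \<in> carrier (padic_ints p)" "b \<in> carrier (padic_ints p)"
       "c \<in> carrier (padic_ints p)" "d \<in> carrier (padic_ints p)" for a b c d
    using that by (simp add: a_minus_def padic_ints_uminus[OF p])
      (simp add: padic_ints_simps mod_simps fun_eq_iff cong_def)
  have subst': "bqf_subst (padic_ints p) (bqf_base_change (padic_ints p) Q) (a, b, c, d) =
        bqf_base_change (padic_ints p) Q' \<longleftrightarrow>
      (\<forall>n. [bqf_value Q (a n) (c n) = l'] (mod int p ^ n) \<and>
        [bqf_polar Q (a n) (c n) (b n) (d n) = m'] (mod int p ^ n) \<and>
        [bqf_value Q (b n) (d n) = r'] (mod int p ^ n))" for a b c d
    unfolding subst by (auto simp: base Q' fun_eq_iff cong_def)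
  show ?thesis
  proof
    assume "SL2_equivalent (padic_ints p) Q Q'"
    then obtain a b c d where carr: "a \<in> carrier (padic_ints p)" "b \<in> carrier (padic_ints p)"
        "c \<in> carrier (padic_ints p)" "d \<in> carrier (padic_ints p)"
      and "a \<otimes>\<^bsub>padic_ints p\<^esub> d \<ominus>\<^bsub>padic_ints p\<^esub> b \<otimes>\<^bsub>padic_ints p\<^esub> c = \<one>\<^bsub>padic_ints p\<^esub>"
      and "bqf_subst (padic_ints p) (bqf_base_change (padic_ints p) Q) (a, b, c, d) =
        bqf_base_change (padic_ints p) Q'"
      unfolding SL2_equivalent_def SL2_def by blast
    hence "\<forall>n. transforms_mod (int p ^ n) Q Q' (a n, b n, c n, d n)"
      unfolding det[OF carr] subst' by (simp add: Q')
    thus "\<exists>a b c d. {a, b, c, d} \<subseteq> carrier (padic_ints p) \<and>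
       (\<forall>n. transforms_mod (int p ^ n) Q Q' (a n, b n, c n, d n))"
      using carr by blast
  next
    assume "\<exists>a b c d. {a, b, c, d} \<subseteq> carrier (padic_ints p) \<and>
       (\<forall>n. transforms_mod (int p ^ n) Q Q' (a n, b n, c n, d n))"
    then obtain a b c d where carr: "a \<in> carrier (padic_ints p)" "b \<in> carrier (padic_ints p)"
        "c \<in> carrier (padic_ints p)" "d \<in> carrier (padic_ints p)"
      and tr: "\<And>n. transforms_mod (int p ^ n) Q Q' (a n, b n, c n, d n)" by auto
    have "(a, b, c, d) \<in> SL2 (padic_ints p)"
      unfolding SL2_def using carr tr by (simp add: det Q')
    moreover have "bqf_subst (padic_ints p) (bqf_base_change (padic_ints p) Q) (a, b, c, d) =
        bqf_base_change (padic_ints p) Q'"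
      unfolding subst' using tr by (simp add: Q')
    ultimately show "SL2_equivalent (padic_ints p) Q Q'"
      unfolding SL2_equivalent_def by blast
  qed
qed

text \<open>
  Koenig's lemma: keep those elements of each \<open>S n\<close> that lift to arbitrarily high levels. They exist,
  and by the pigeonhole principle each of them has a preimage of the same kind one level up.
\<close>

lemma inverse_limit_nonempty:
  fixes S :: "nat \<Rightarrow> 'a set" and f :: "nat \<Rightarrow> 'a \<Rightarrow> 'a"
  assumes fin: "\<And>n. finite (S n)" and ne: "\<And>n. S n \<noteq> {}"
    and f: "\<And>n x. x \<in> S (Suc n) \<Longrightarrow> f n x \<in> S n"
  obtains x where "\<And>n. x n \<in> S n" "\<And>n. f n (x (Suc n)) = x n"
proof -
  \<comment> \<open>\<open>ext k n x\<close>: the element \<open>x\<close> of \<open>S n\<close> begins a compatible chain up to level \<open>n + k\<close>\<close>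
  define ext where "ext = rec_nat (\<lambda>n x. x \<in> S n)
     (\<lambda>_ E n x. x \<in> S n \<and> (\<exists>y \<in> S (Suc n). f n y = x \<and> E (Suc n) y))"
  have ext_0: "ext 0 n x \<longleftrightarrow> x \<in> S n"
    and ext_Suc: "ext (Suc k) n x \<longleftrightarrow> x \<in> S n \<and> (\<exists>y \<in> S (Suc n). f n y = x \<and> ext k (Suc n) y)"
    for k n x by (simp_all add: ext_def)
  have mono: "ext k n x" if "ext k' n x" "k \<le> k'" for k k' n x
    using that
  proof (induction k arbitrary: k' n x)
    case 0
    thus ?case by (cases k') (auto simp: ext_0 ext_Suc)
  next
    case (Suc k)
    then obtain j where "k' = Suc j" "k \<le> j" by (metis Suc_le_D Suc_le_mono)
    thus ?case using Suc by (auto simp: ext_Suc)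
  qed
  have ex: "\<exists>x. ext k n x" for k n
  proof (induction k arbitrary: n)
    case 0
    thus ?case using ne by (auto simp: ext_0)
  next
    case (Suc k)
    then obtain y where y: "ext k (Suc n) y" by blast
    hence "y \<in> S (Suc n)" by (cases k) (auto simp: ext_0 ext_Suc)
    with y f have "ext (Suc k) n (f n y)" by (auto simp: ext_Suc)
    thus ?case by blast
  qed
  have pigeon: "\<exists>y \<in> A. \<forall>k. ext k n y" if A: "finite A" "\<And>k. \<exists>y \<in> A. ext k n y" for A n
  proof (rule ccontr)
    assume "\<not> ?thesis"
    then obtain K where K: "\<And>y. y \<in> A \<Longrightarrow> \<not> ext (K y) n y" by metis
    from A(2)[of "Max (K ` A)"] obtain y where "y \<in> A" "ext (Max (K ` A)) n y" by blast
    with K[of y] mono[of "Max (K ` A)" n y "K y"] A(1) show False by simp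
  qed
  have base: "\<exists>x. x \<in> S 0 \<and> (\<forall>k. ext k 0 x)"
  proof -
    have "x \<in> S 0" if "ext k 0 x" for k x using mono[OF that, of 0] by (simp add: ext_0)
    hence "\<exists>x \<in> S 0. ext k 0 x" for k using ex[of k 0] by blast
    from pigeon[OF fin this] show ?thesis by blast
  qed
  have step: "\<exists>y. (y \<in> S (Suc n) \<and> (\<forall>k. ext k (Suc n) y)) \<and> f n y = x"
    if x: "x \<in> S n \<and> (\<forall>k. ext k n x)" for x n
  proof -
    have "\<exists>y \<in> {y \<in> S (Suc n). f n y = x}. ext k (Suc n) y" for k
      using x[THEN conjunct2, THEN spec, of "Suc k"] by (auto simp: ext_Suc)
    from pigeon[OF _ this] fin show ?thesis by auto
  qed
  obtain x where "\<And>n. x n \<in> S n \<and> (\<forall>k. ext k n (x n))" "\<And>n. f n (x (Suc n)) = x n"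
    using dependent_nat_choice[of "\<lambda>n x. x \<in> S n \<and> (\<forall>k. ext k n x)" "\<lambda>n x y. f n y = x"]
      base step by metis
  thus ?thesis using that by blast
qed

lemma SL2_equivalent_padic_if_mod:
  assumes p: "p > 0" and ex: "\<And>n. \<exists>g. transforms_mod (int p ^ n) Q Q' g"
  shows "SL2_equivalent (padic_ints p) Q Q'"
proof -
  define S where "S = (\<lambda>n. {g \<in> {0..<int p ^ n} \<times> {0..<int p ^ n} \<times> {0..<int p ^ n} \<times> {0..<int p ^ n}.
     transforms_mod (int p ^ n) Q Q' g})"
  define red where "red = (\<lambda>n (a, b, c, d). (a mod int p ^ n, b mod int p ^ n, c mod int p ^ n, d mod int p ^ n))"
  have red: "red n g \<in> S n" if "transforms_mod (int p ^ n) Q Q' g" for n g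
    using that p by (cases g) (auto simp: S_def red_def elim!: transforms_mod_cong[rotated 4])
  have "red n g \<in> S n" if "g \<in> S (Suc n)" for n g
  proof (rule red)
    obtain a b c d where g: "g = (a, b, c, d)" by (cases g)
    obtain l m r where Q': "Q' = BQF l m r" by (cases Q')
    have dvd: "int p ^ n dvd int p ^ Suc n" by simp
    from that show "transforms_mod (int p ^ n) Q Q' g"
      using cong_dvd_modulus[OF _ dvd] by (auto simp: S_def g Q')
  qed
  moreover have "S n \<noteq> {}" for n using ex[of n] red by blast
  moreover have "finite (S n)" for n unfolding S_def by simp
  ultimately obtain g where g: "\<And>n. g n \<in> S n" "\<And>n. red n (g (Suc n)) = g n"
    using inverse_limit_nonempty[of S red] by metis
  define a b c d where defs: "a = (\<lambda>n. fst (g n))" "b = (\<lambda>n. fst (snd (g n)))"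
    "c = (\<lambda>n. fst (snd (snd (g n))))" "d = (\<lambda>n. snd (snd (snd (g n))))"
  have g_eq: "g n = (a n, b n, c n, d n)" for n by (simp add: defs)
  have "{a, b, c, d} \<subseteq> carrier (padic_ints p)"
    using g by (auto simp: padic_ints_carrier_iff S_def red_def g_eq)
  moreover have "transforms_mod (int p ^ n) Q Q' (a n, b n, c n, d n)" for n
    using g(1)[of n] by (auto simp: S_def g_eq)
  ultimately show ?thesis unfolding SL2_equivalent_padic_iff[OF p] by blast
qed

lemma transforms_mod_if_represents_unit:
  assumes disc: "bqf_discriminant Q = bqf_discriminant (BQF u m' r')"
    and u: "coprime u N" and rep: "[bqf_value Q a c = u] (mod N)"
  shows "\<exists>g. transforms_mod N Q (BQF u m' r') g"
proof -
  obtain l m r where Q: "Q = BQF l m r" by (cases Q)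
  obtain h where h: "m' = m + 2 * h" "h * (h + m) + l * r = u * r'"
    using discriminant_eq_imp_half_difference disc unfolding Q by blast
  obtain v where v: "[u * v = 1] (mod N)" using u cong_solve_coprime_int by blast
  define b where "b = v * (a * h - r * c)"
  define d where "d = v * (c * (h + m) + l * a)"
  have vN: "[v * bqf_value Q a c = 1] (mod N)"
    using cong_trans[OF cong_mult[OF cong_refl rep] v[unfolded mult.commute[of u]]] .
  note col = second_column[OF refl h(2) b_def d_def, folded Q]
  have "[a * d - b * c = 1] (mod N)" unfolding col(1) by (rule vN)
  moreover have "[bqf_polar Q a c b d = 1 * (m + 2 * h)] (mod N)"
    unfolding col(2) by (intro cong_mult cong_refl vN)
  moreover have "[bqf_value Q b d = (u * v) * r'] (mod N)"
    unfolding col(3) using cong_mult[OF cong_mult[OF cong_refl[of v] vN] cong_refl[of "u * r'"]]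
    by (simp add: algebra_simps)
  hence "[bqf_value Q b d = 1 * r'] (mod N)"
    using cong_mult[OF v cong_refl[of r']] cong_trans by blast
  ultimately show ?thesis
    using rep by (intro exI[of _ "(a, b, c, d)"]) (simp add: h(1))
qed

section \<open>Rational equivalence implies p-adic equivalence\<close>

text \<open>
  The derivative \<open>m + 2 l x\<close> is congruent to \<open>m\<close> modulo \<open>p\<close>, hence a unit for every \<open>x\<close>, and Newton's
  iteration may start from any \<open>x\<close>.
\<close>

lemma hensel_quadratic:
  fixes l m s :: int
  assumes p: "prime p" "int p dvd l" "\<not> int p dvd m"
  shows "\<exists>x. int p ^ k dvd l * x\<^sup>2 + m * x + s"
proof (induction k)
  case (Suc k)
  then obtain x q where q: "l * x\<^sup>2 + m * x + s = int p ^ k * q" by (auto elim: dvdE)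
  have "\<not> int p dvd m + 2 * l * x"
    using p(2,3) by (metis dvd_add_left_iff dvd_mult dvd_mult2)
  hence "coprime (m + 2 * l * x) (int p)"
    using p(1) by (metis coprime_commute prime_imp_coprime prime_int_nat_transfer nat_int of_nat_0_le_iff)
  then obtain w where w: "[(m + 2 * l * x) * w = 1] (mod int p)"
    using cong_solve_coprime_int by blast
  \<comment> \<open>the Newton correction: it makes \<open>q + (m + 2 l x) t\<close> vanish modulo \<open>p\<close>\<close>
  define t where "t = - w * q"
  have "[q + (m + 2 * l * x) * t = q - 1 * q] (mod int p)"
    unfolding t_def using cong_diff[OF cong_refl[of q] cong_mult[OF w cong_refl[of q]]]
    by (simp add: algebra_simps)
  hence 1: "int p dvd q + (m + 2 * l * x) * t" by (simp add: cong_0_iff)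
  obtain l' where l': "l = int p * l'" using p(2) by blast
  have "l * (x + int p ^ k * t)\<^sup>2 + m * (x + int p ^ k * t) + s =
      (l * x\<^sup>2 + m * x + s) + int p ^ k * ((m + 2 * l * x) * t) + (int p ^ k) * (l * t\<^sup>2 * int p ^ k)"
    by (simp add: algebra_simps power2_eq_square)
  also have "\<dots> = int p ^ k * (q + (m + 2 * l * x) * t + int p * (l' * t\<^sup>2 * int p ^ k))"
    unfolding q by (simp add: algebra_simps l')
  also have "int p ^ k * int p dvd \<dots>"
    by (intro mult_dvd_mono dvd_add[OF 1]) auto
  finally show ?case by (intro exI[of _ "x + int p ^ k * t"]) (simp add: mult.commute)
qed simp

text \<open>
  The numbers congruent to \<open>z\<^sup>2\<close> modulo \<open>4 p\<^sup>2\<close> for some multiple \<open>z = p y\<close> of \<open>p\<close> are those of the form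
  \<open>p\<^sup>2 (y\<^sup>2 + 4 k)\<close>, that is, \<open>p\<^sup>2\<close> times a discriminant. So the condition says that the quadratic order
  of discriminant \<open>\<Delta>\<close> is maximal at \<open>p\<close>. In this form it covers odd \<open>p\<close> and \<open>p = 2\<close> together.
\<close>

definition maximal_at :: "nat \<Rightarrow> int \<Rightarrow> bool" where
  "maximal_at p \<Delta> \<longleftrightarrow> (\<forall>z. int p dvd z \<longrightarrow> \<not> [\<Delta> = z\<^sup>2] (mod 4 * (int p)\<^sup>2))"

text \<open>
  In the contrary case \<open>p\<^sup>2\<close> divides \<open>\<Delta>\<close>, which is excluded by squarefreeness except for \<open>p = 2\<close>
  and \<open>\<Delta> = 4 m\<close>. There \<open>m\<close> would be congruent to a square modulo \<open>4\<close>, but it is neither \<open>0\<close> nor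
  \<open>1\<close> modulo \<open>4\<close>.
\<close>

lemma fundamental_discriminant_maximal_at:
  assumes "fundamental_discriminant \<Delta>" "prime p"
  shows "maximal_at p \<Delta>"
  unfolding maximal_at_def
proof (intro allI impI notI)
  fix z :: int
  assume z: "int p dvd z" and cong: "[\<Delta> = z\<^sup>2] (mod 4 * (int p)\<^sup>2)"
  obtain y where y: "z = int p * y" using z by blast
  have p2: "(int p)\<^sup>2 dvd \<Delta>"
  proof -
    have "[\<Delta> = z\<^sup>2] (mod (int p)\<^sup>2)" using cong_dvd_modulus[OF cong] by simp
    moreover have "(int p)\<^sup>2 dvd z\<^sup>2" using z by (rule dvd_power_same)
    ultimately show ?thesis using cong_dvd_iff by blast
  qed
  have np: "\<not> int p dvd 1" using assms(2) by (auto dest: prime_gt_1_nat)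
  hence sf: "\<not> (int p)\<^sup>2 dvd u" if "squarefree u" for u
    using that squarefreeD by blast
  from assms(1) show False unfolding fundamental_discriminant_def
  proof (elim disjE exE conjE)
    assume "squarefree \<Delta>"
    thus False using sf p2 by blast
  next
    fix m assume m: "\<Delta> = 4 * m" "squarefree m" "\<not> [m = 1] (mod 4)"
    show False
    proof (cases "p = 2")
      case True
      have "4 * 4 dvd 4 * (m - y\<^sup>2)"
        using cong True by (simp add: cong_iff_dvd_diff y m(1) power_mult_distrib algebra_simps)
      hence my: "[m = y\<^sup>2] (mod 4)" by (subst (asm) dvd_mult_cancel_left) (simp add: cong_iff_dvd_diff)
      show False
      proof (cases "even y")
        case True
        hence "(2::int)\<^sup>2 dvd y\<^sup>2" by (rule dvd_power_same)
        hence "(int p)\<^sup>2 dvd m" using my \<open>p = 2\<close> by (simp add: cong_dvd_iff)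
        thus False using sf m(2) by blast
      next
        case False
        then obtain k where "y = 2 * k + 1" by (elim oddE)
        hence "y\<^sup>2 - 1 = 4 * (k\<^sup>2 + k)" by (simp add: power2_eq_square algebra_simps)
        hence "[y\<^sup>2 = 1] (mod 4)" by (simp add: cong_iff_dvd_diff)
        thus False using my m(3) cong_trans by blast
      qed
    next
      case False
      hence "coprime p 2" using assms(2) primes_coprime two_is_prime_nat by blast
      hence "coprime (int p) 2" by (metis coprime_int_iff of_nat_numeral)
      hence "coprime ((int p)\<^sup>2) (2\<^sup>2)"
        by (metis coprime_power_left_iff coprime_power_right_iff)
      hence "(int p)\<^sup>2 dvd m" using p2 m(1) by (simp add: coprime_dvd_mult_right_iff)
      thus False using sf m(2) by blast
    qed
  qed
qed

text \<open>
  In a basis of \<open>\<int>\<^sup>2\<close> that starts with \<open>(x, y)\<close>, the form has a leading coefficient divisible by \<open>p\<^sup>2\<close>,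
  so \<open>\<Delta>\<close> is congruent modulo \<open>4 p\<^sup>2\<close> to the square of the middle coefficient. By maximality \<open>p\<close> does
  not divide the middle coefficient, and Hensel's lemma applies.
\<close>

lemma represents_mod_if_isotropic:
  assumes p: "prime p" and max: "maximal_at p (bqf_discriminant Q)"
    and xy: "coprime x y" "(int p)\<^sup>2 dvd bqf_value Q x y"
  shows "\<exists>a c. [bqf_value Q a c = u] (mod int p ^ k)"
proof -
  obtain d b' where "x * d + y * b' = 1"
    using xy(1) bezout_int[of x y] by (metis coprime_iff_gcd_eq_1 mult.commute)
  define b where "b = - b'"
  have det: "x * d - b * y = 1" using \<open>x * d + y * b' = 1\<close> by (simp add: b_def algebra_simps)
  define l where "l = bqf_value Q x y"
  define m where "m = bqf_polar Q x y b d"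
  define r where "r = bqf_value Q b d"
  have "bqf_discriminant Q = m\<^sup>2 - 4 * l * r"
    using discriminant_transform[of Q x y b d] by (simp add: det l_def m_def r_def)
  hence "[bqf_discriminant Q = m\<^sup>2] (mod 4 * (int p)\<^sup>2)"
    using xy(2) by (auto simp: cong_iff_dvd_diff l_def mult.assoc intro!: mult_dvd_mono dvd_mult2)
  hence "\<not> int p dvd m" using max by (auto simp: maximal_at_def)
  moreover have "int p dvd l"
    using xy(2) by (metis dvd_mult_left l_def power2_eq_square)
  ultimately obtain t where "int p ^ k dvd l * t\<^sup>2 + m * t + (r - u)"
    using hensel_quadratic[OF p] by blast
  moreover have "bqf_value Q (x * t + b * 1) (y * t + d * 1) = l * t\<^sup>2 + m * t + r"
    unfolding bqf_value_linear_combination by (simp add: l_def m_def r_def)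
  ultimately have "[bqf_value Q (x * t + b * 1) (y * t + d * 1) = u] (mod int p ^ k)"
    by (simp add: cong_iff_dvd_diff algebra_simps)
  thus ?thesis by blast
qed

text \<open>
  In lowest terms the representation is \<open>Q(h x', h y') = u w'\<^sup>2\<close> with \<open>x'\<close>, \<open>y'\<close> coprime and \<open>h\<close>, \<open>w'\<close>
  coprime. Either \<open>w'\<close> is invertible at \<open>p\<close>, or \<open>p\<^sup>2\<close> divides \<open>Q(x', y')\<close>.
\<close>

lemma represents_mod_if_represents_rat:
  assumes p: "prime p" and max: "maximal_at p (bqf_discriminant Q)"
    and rep: "bqf_value Q x y = u * w\<^sup>2" "u \<noteq> 0" "w \<noteq> 0"
  shows "\<exists>a c. [bqf_value Q a c = u] (mod int p ^ k)"
proof -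
  define g where "g = gcd x y"
  have "(x, y) \<noteq> (0, 0)" using rep by (cases Q) auto
  hence g: "g \<noteq> 0" by (auto simp: g_def)
  obtain x' y' where xy: "x = g * x'" "y = g * y'" "coprime x' y'"
    using gcd_coprime_exists[of x y] g by (metis g_def mult.commute)
  obtain h w' where gw: "g = gcd g w * h" "w = gcd g w * w'" "coprime h w'"
    using gcd_coprime_exists[of g w] g by (metis gcd_eq_0_iff mult.commute)
  have "(gcd g w)\<^sup>2 * (h\<^sup>2 * bqf_value Q x' y') = (gcd g w)\<^sup>2 * (u * w'\<^sup>2)"
    using rep(1) gw(1,2) unfolding xy(1,2) bqf_value_scale
    by (metis mult.assoc mult.left_commute power_mult_distrib)
  hence eq: "h\<^sup>2 * bqf_value Q x' y' = u * w'\<^sup>2" using g by simp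
  show ?thesis
  proof (cases "int p dvd w'")
    case True
    hence "coprime (int p) h"
      using gw(3) by (meson coprime_commute coprime_divisors dvd_refl)
    hence "coprime ((int p)\<^sup>2) (h\<^sup>2)" by simp
    moreover have "(int p)\<^sup>2 dvd h\<^sup>2 * bqf_value Q x' y'"
      unfolding eq using True by (intro dvd_mult dvd_power_same)
    ultimately have "(int p)\<^sup>2 dvd bqf_value Q x' y'"
      by (simp add: coprime_dvd_mult_right_iff)
    thus ?thesis using represents_mod_if_isotropic[OF p max xy(3)] by blast
  next
    case False
    hence "coprime (int p) w'" using p by (intro prime_imp_coprime) auto
    hence "coprime w' (int p ^ k)" by (simp add: coprime_commute)
    then obtain v where v: "[w' * v = 1] (mod int p ^ k)" using cong_solve_coprime_int by blast
    have "bqf_value Q (v * h * x') (v * h * y') = u * (w' * v)\<^sup>2"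
      unfolding bqf_value_scale using eq by (simp add: power_mult_distrib algebra_simps)
    also have "[\<dots> = u * 1\<^sup>2] (mod int p ^ k)" using v by (intro cong_mult cong_refl cong_pow)
    finally show ?thesis by auto
  qed
qed

text \<open>
  One of the values \<open>l\<close>, \<open>r\<close>, \<open>l + m + r\<close> at \<open>(1, 0)\<close>, \<open>(0, 1)\<close>, \<open>(1, 1)\<close> is prime to \<open>p\<close>, and each of
  these vectors is the first column of a matrix in \<open>SL\<^sub>2(\<int>)\<close>. The matrix in the conclusion is its
  inverse.
\<close>

lemma primitive_unit_leading_coeff:
  assumes p: "prime p" and prim: "bqf_primitive Q"
  obtains x y m r a b c d where "\<not> int p dvd bqf_value Q x y"
    "bqf_discriminant (BQF (bqf_value Q x y) m r) = bqf_discriminant Q"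
    "\<And>N. transforms_mod N (BQF (bqf_value Q x y) m r) Q (a, b, c, d)"
proof -
  obtain l m r where Q: "Q = BQF l m r" by (cases Q)
  have "\<not> (int p dvd l \<and> int p dvd m \<and> int p dvd r)"
  proof
    assume "int p dvd l \<and> int p dvd m \<and> int p dvd r"
    hence "int p dvd Gcd {l, m, r}" by (intro Gcd_greatest) auto
    hence "int p dvd 1" using prim by (simp only: Q bqf_primitive.simps)
    thus False using p by (auto dest: prime_gt_1_nat)
  qed
  then consider "\<not> int p dvd l" | "\<not> int p dvd r" | "\<not> int p dvd l + m + r"
    by (metis dvd_add_left_iff dvd_add_right_iff)
  thus ?thesis
  proof cases
    case 1
    show ?thesis
      by (rule that[of 1 0 m r 1 0 0 1]) (use 1 in \<open>auto simp: Q\<close>)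
  next
    case 2
    show ?thesis
      by (rule that[of 0 1 "- m" l 0 1 "- 1" 0]) (use 2 in \<open>auto simp: Q\<close>)
  next
    case 3
    show ?thesis
      by (rule that[of 1 1 "m + 2 * r" r 1 0 "- 1" 1])
         (use 3 in \<open>auto simp: Q algebra_simps power2_eq_square\<close>)
  qed
qed

lemma Q_equivalent_imp_padic_equivalent:
  assumes Q: "bqf_primitive Q'" "bqf_discriminant Q = bqf_discriminant Q'"
    and p: "prime p" and max: "maximal_at p (bqf_discriminant Q)" and eq: "Q_equivalent Q Q'"
  shows "SL2_equivalent (padic_ints p) Q Q'"
proof -
  obtain s t m r a b c d where u: "\<not> int p dvd bqf_value Q' s t"
    and disc: "bqf_discriminant (BQF (bqf_value Q' s t) m r) = bqf_discriminant Q'"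
    and from_unit: "\<And>N. transforms_mod N (BQF (bqf_value Q' s t) m r) Q' (a, b, c, d)"
    using primitive_unit_leading_coeff[OF p Q(1)] by metis
  define u where "u = bqf_value Q' s t"
  obtain x y w where xyw: "bqf_value Q x y = u * w\<^sup>2" "w \<noteq> 0"
    using Q_equivalent_imp_represents[OF eq] unfolding u_def by blast
  have "\<exists>g. transforms_mod (int p ^ n) Q Q' g" for n
  proof -
    have "u \<noteq> 0" using u by (auto simp: u_def)
    then obtain a' c' where "[bqf_value Q a' c' = u] (mod int p ^ n)"
      using represents_mod_if_represents_rat[OF p max xyw(1) _ xyw(2)] by blast
    moreover have "coprime (int p) u" using p u by (intro prime_imp_coprime) (auto simp: u_def)
    hence "coprime u (int p ^ n)" by (simp add: coprime_commute)
    ultimately obtain g' where "transforms_mod (int p ^ n) Q (BQF u m r) g'"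
      using transforms_mod_if_represents_unit[of Q u m r] Q(2) disc unfolding u_def by metis
    thus ?thesis using transforms_mod_trans from_unit unfolding u_def by (metis prod_cases4)
  qed
  thus ?thesis using p by (intro SL2_equivalent_padic_if_mod) (auto simp: prime_gt_0_nat)
qed

section \<open>Genus equivalence and rational equivalence\<close>

lemma bqf_complete_square:
  "(2 * l * x + m * y)\<^sup>2 - bqf_discriminant (BQF l m r) * y\<^sup>2 = 4 * l * bqf_value (BQF l m r) x y"
  by (simp add: algebra_simps power2_eq_square)

text \<open>
  The first columns of the local equivalences represent \<open>l'\<close> by \<open>Q\<close>, and so give points with \<open>Z = 1\<close>
  on the conic \<open>X\<^sup>2 - \<Delta> Y\<^sup>2 = 4 l l' Z\<^sup>2\<close>. A global point of the conic represents \<open>l'\<close> over \<open>\<rat>\<close>.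
\<close>

lemma genus_equivalent_imp_Q_equivalent:
  assumes nsq: "\<not> is_square (bqf_discriminant Q)"
    and disc: "bqf_discriminant Q' = bqf_discriminant Q" and genus: "genus_equivalent Q Q'"
  shows "Q_equivalent Q Q'"
proof -
  obtain l m r where Q: "Q = BQF l m r" by (cases Q)
  obtain l' m' r' where Q': "Q' = BQF l' m' r'" by (cases Q')
  define \<Delta> where "\<Delta> = bqf_discriminant Q"
  have nsq': "\<Delta> \<noteq> z\<^sup>2" for z using nsq by (auto simp: \<Delta>_def)
  have l: "l \<noteq> 0" "l' \<noteq> 0"
    using nsq'[of m] nsq'[of m'] disc by (auto simp: \<Delta>_def Q Q')
  have \<Delta>0: "\<Delta> \<noteq> 0" using nsq'[of 0] by simp
  have at: "conic_soluble_at p \<Delta> (4 * l * l')" if p: "prime p" for p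
  proof -
    have "p > 0" "SL2_equivalent (padic_ints p) Q Q'"
      using genus p by (auto simp: genus_equivalent_def prime_gt_0_nat)
    then obtain a c where ac: "\<And>n. [bqf_value Q (a n) (c n) = l'] (mod int p ^ n)"
      unfolding SL2_equivalent_padic_iff[OF \<open>p > 0\<close>] Q' by auto
    have "int p ^ n dvd (2 * l * a n + m * c n)\<^sup>2 - \<Delta> * (c n)\<^sup>2 - 4 * l * l' * 1\<^sup>2" for n
    proof -
      have "(2 * l * a n + m * c n)\<^sup>2 - \<Delta> * (c n)\<^sup>2 - 4 * l * l' * 1\<^sup>2 =
          4 * l * (bqf_value Q (a n) (c n) - l')"
        unfolding \<Delta>_def Q bqf_complete_square by (simp add: algebra_simps)
      thus ?thesis using ac[of n] by (simp add: cong_iff_dvd_diff)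
    qed
    \<comment> \<open>since \<open>Z = 1\<close>, the bound \<open>C = 1\<close> serves for all \<open>n\<close>\<close>
    moreover have "\<not> int p ^ 1 dvd 1" using p by (auto dest: prime_gt_1_nat)
    ultimately show ?thesis unfolding conic_soluble_at_def by blast
  qed
  have real: "\<Delta> > 0 \<or> 4 * l * l' > 0"
  proof (rule disjCI)
    assume "\<not> 4 * l * l' > 0"
    hence ll: "4 * l * l' < 0" using l by (simp add: not_less order_le_less)
    obtain a c :: real where ac: "bqf_value (map_bqf of_int Q) a c = of_int l'"
      using genus unfolding genus_equivalent_def Q' SL2_equivalent_type_algebra_iff by blast
    have "(2 * of_int l * a + of_int m * c)\<^sup>2 - of_int \<Delta> * c\<^sup>2 =
        4 * of_int l * bqf_value (map_bqf of_int Q) a c"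
      by (simp add: \<Delta>_def Q algebra_simps power2_eq_square)
    also have "\<dots> = of_int (4 * l * l')" by (simp add: ac)
    also have "\<dots> < 0" using ll by (simp only: of_int_less_0_iff)
    finally have "of_int \<Delta> * c\<^sup>2 > 0" using zero_le_power2[of "2 * of_int l * a + of_int m * c"] by linarith
    thus "\<Delta> > 0" by (simp add: zero_less_mult_iff)
  qed
  have "conic_soluble \<Delta> (4 * l * l')"
    using conic_local_global[OF \<Delta>0 _ real at] l by simp
  then obtain x y z where xyz: "(x, y, z) \<noteq> (0, 0, 0)" "x\<^sup>2 - \<Delta> * y\<^sup>2 - 4 * l * l' * z\<^sup>2 = 0"
    unfolding conic_soluble_def by auto
  have z: "z \<noteq> 0"
  proof
    assume z: "z = 0"
    hence eq: "x\<^sup>2 = \<Delta> * y\<^sup>2" using xyz(2) by simp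
    hence "y \<noteq> 0" using xyz(1) z by auto
    moreover have "y\<^sup>2 dvd x\<^sup>2" by (simp add: eq)
    hence "y dvd x" by simp
    then obtain k where "x = y * k" by blast
    ultimately have "\<Delta> = k\<^sup>2" using eq by (simp add: power_mult_distrib)
    thus False using nsq' by blast
  qed
  define a c :: rat where "a = (of_int x - of_int m * of_int y) / (2 * of_int l * of_int z)"
    and "c = of_int y / of_int z"
  have x: "2 * of_int l * a + of_int m * c = of_int x / of_int z"
    using z l by (simp add: a_def c_def field_simps)
  have "4 * of_int l * bqf_value (map_bqf of_int Q) a c =
      (2 * of_int l * a + of_int m * c)\<^sup>2 - of_int \<Delta> * c\<^sup>2"
    by (simp add: \<Delta>_def Q algebra_simps power2_eq_square)
  also have "\<dots> = of_int (x\<^sup>2 - \<Delta> * y\<^sup>2) / (of_int z)\<^sup>2"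
    unfolding x by (simp add: c_def power_divide diff_divide_distrib)
  also have "x\<^sup>2 - \<Delta> * y\<^sup>2 = 4 * l * l' * z\<^sup>2" using xyz(2) by simp
  also have "of_int \<dots> / (of_int z)\<^sup>2 = (4 * of_int l * of_int l' :: rat)" using z by simp
  finally have "bqf_value (map_bqf of_int Q) a c = of_int l'" using l by simp
  thus ?thesis
    using disc l unfolding Q' by (intro Q_equivalent_if_represents) auto
qed

theorem mainTheorem4:
  shows "(\<forall>\<Delta>::int. \<not> is_square \<Delta> \<longrightarrow>
            (\<forall>Q \<in> primitive_forms \<Delta>. \<forall>Q' \<in> primitive_forms \<Delta>.
               genus_equivalent Q Q' \<longrightarrow> Q_equivalent Q Q')) \<and>
         (\<forall>\<Delta>::int. fundamental_discriminant \<Delta> \<longrightarrow>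
            (\<forall>Q \<in> primitive_forms \<Delta>. \<forall>Q' \<in> primitive_forms \<Delta>.
               Q_equivalent Q Q' \<longrightarrow> genus_equivalent Q Q'))"
proof (intro conjI allI ballI impI)
  fix \<Delta> Q Q'
  assume "\<not> is_square \<Delta>" "Q \<in> primitive_forms \<Delta>" "Q' \<in> primitive_forms \<Delta>" "genus_equivalent Q Q'"
  thus "Q_equivalent Q Q'"
    by (intro genus_equivalent_imp_Q_equivalent) (auto simp: primitive_forms_def)
next
  fix \<Delta> Q Q'
  assume \<Delta>: "fundamental_discriminant \<Delta>" and Q: "Q \<in> primitive_forms \<Delta>" "Q' \<in> primitive_forms \<Delta>"
    and eq: "Q_equivalent Q Q'"
  show "genus_equivalent Q Q'"
    unfolding genus_equivalent_def
  proof (intro conjI allI impI)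
    fix p :: nat assume "prime p"
    thus "SL2_equivalent (padic_ints p) Q Q'"
      using Q eq fundamental_discriminant_maximal_at[OF \<Delta>]
      by (intro Q_equivalent_imp_padic_equivalent) (auto simp: primitive_forms_def)
  next
    show "SL2_equivalent (ring_of_type_algebra :: real ring) Q Q'"
      using eq SL2_equivalent_rat_imp_real unfolding Q_equivalent_def by blast
  qed
qed

end
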